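(* Let $\{X_i\}_{i\ge 1}$ be a strictly stationary $m$-dependent sequence of random vectors in $\mathbb{R}^d$ with marginal density $p\in L_2(\mathbb{R}^d)$, and let $\epsilon=\epsilon(n)>0$ with $\epsilon(n)\to 0$ as $n\to\infty$. Let $\tilde Q_n$ and $\tilde H_n$ be the estimators of $q_2$ and $h_2$ defined in the context. (i) If Assumption $\mathcal{A}$ holds and $n^2\epsilon^d\to\infty$, then $\tilde Q_n\to q_2$ in probability and $\tilde H_n\to h_2$ in probability as $n\to\infty$. (ii) Suppose $p\in L_3(\mathbb{R}^d)$ and $P(X_i\ne X_j)=1$ for all $i\ne j$ (Assumption $\mathcal{A}$ is not required). If $n\epsilon^d\to a$ with $0<a\le\infty$, then $\tilde Q_n\to q_2$ in probability and $\tilde H_n\to h_2$ in probability as $n\to\infty$.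
   Context: $m\ge 0$ is a fixed integer. $\{X_i\}$ is $m$-dependent if the families $\{X_{a-r},\dots,X_a\}$ and $\{X_b,\dots,X_{b+s}\}$ are independent whenever $b-a>m$. $\|\cdot\|$ is the Euclidean norm on $\mathbb{R}^d$ and $I(D)$ is the indicator of $D$. $q_2:=\int_{\mathbb{R}^d}p(x)^2\,dx$ and $h_2:=-\log q_2$ (quadratic Rényi entropy of the marginal distribution). $b_1(d)=2\pi^{d/2}/(d\,\Gamma(d/2))$ and $b_\epsilon(d)=\epsilon^d b_1(d)$ is the volume of a ball of radius $\epsilon$. Estimators: $N_n:=\sum_{1\le i<j\le n} I(\|X_i-X_j\|\le\epsilon(n))$, $\tilde Q_n:=\binom{n}{2}^{-1}N_n/b_{\epsilon(n)}(d)$, $\tilde H_n:=-\log(\max(\tilde Q_n,1/n))$. Assumption $\mathcal{A}$: $p\in L_3(\mathbb{R}^d)$, and for each $4$-tuple of distinct positive integers $\mathbf{t}=(t_1,t_2,t_3,t_4)$ the vector $(X_{t_1},X_{t_2},X_{t_3},X_{t_4})$ has a density $p_{\mathbf{t}}(x_1,x_2,x_3,x_4)$ in $\mathbb{R}^{4d}$ such that $g_{\mathbf{t}}(x_1,x_2):=\left(\int_{\mathbb{R}^{2d}}p_{\mathbf{t}}(x_1,x_2,x_3,x_4)^2\,dx_3\,dx_4\right)^{1/2}$ belongs to $L_1(\mathbb{R}^{2d})$. *)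

theory Defs
  imports "HOL-Probability.Probability"
begin

text \<open>
  A sequence \<open>X\<^sub>1, X\<^sub>2, \<dots>\<close> is a function on \<^typ>\<open>nat\<close> of which only the values at indices
  \<open>i \<ge> 1\<close> are used; nothing is assumed about \<open>X 0\<close>.
\<close>

definition strictly_stationary ::
    "'a measure \<Rightarrow> (nat \<Rightarrow> 'a \<Rightarrow> 'v::topological_space) \<Rightarrow> bool" where
  "strictly_stationary M X \<longleftrightarrow>
     (\<forall>i\<ge>1. X i \<in> borel_measurable M) \<and>
     (\<forall>J h. finite J \<and> J \<subseteq> {1..} \<longrightarrow>
        distr M (PiM J (\<lambda>_. borel)) (\<lambda>\<omega>. \<lambda>i\<in>J. X (i + h) \<omega>) =
        distr M (PiM J (\<lambda>_. borel)) (\<lambda>\<omega>. \<lambda>i\<in>J. X i \<omega>))"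

definition m_dependent ::
    "'a measure \<Rightarrow> nat \<Rightarrow> (nat \<Rightarrow> 'a \<Rightarrow> 'v::topological_space) \<Rightarrow> bool" where
  "m_dependent M m X \<longleftrightarrow>
     (\<forall>a b r s. r < a \<and> a + m < b \<longrightarrow>
        prob_space.indep_var M
          (PiM {a - r..a} (\<lambda>_. borel)) (\<lambda>\<omega>. \<lambda>i\<in>{a - r..a}. X i \<omega>)
          (PiM {b..b + s} (\<lambda>_. borel)) (\<lambda>\<omega>. \<lambda>i\<in>{b..b + s}. X i \<omega>))"

definition in_L :: "nat \<Rightarrow> ('v::euclidean_space \<Rightarrow> real) \<Rightarrow> bool" where
  "in_L k f \<longleftrightarrow> f \<in> borel_measurable lborel \<and> integrable lborel (\<lambda>x. \<bar>f x\<bar> ^ k)"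

definition conv_in_prob :: "'a measure \<Rightarrow> (nat \<Rightarrow> 'a \<Rightarrow> real) \<Rightarrow> real \<Rightarrow> bool" where
  "conv_in_prob M Y c \<longleftrightarrow>
     (\<forall>\<delta>>0. (\<lambda>n. measure M {\<omega> \<in> space M. \<bar>Y n \<omega> - c\<bar> > \<delta>}) \<longlonglongrightarrow> 0)"

definition q2 :: "('v::euclidean_space \<Rightarrow> real) \<Rightarrow> real" where
  "q2 p = (LINT x|lborel. (p x)\<^sup>2)"

definition h2 :: "('v::euclidean_space \<Rightarrow> real) \<Rightarrow> real" where
  "h2 p = - ln (q2 p)"

definition ball_vol :: "nat \<Rightarrow> real \<Rightarrow> real" where
  "ball_vol d \<epsilon> = \<epsilon> ^ d * (2 * pi powr (real d / 2) / (real d * Gamma (real d / 2)))"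

definition N_est :: "(nat \<Rightarrow> 'a \<Rightarrow> real^'d) \<Rightarrow> (nat \<Rightarrow> real) \<Rightarrow> nat \<Rightarrow> 'a \<Rightarrow> real" where
  "N_est X \<epsilon> n \<omega> = (\<Sum>j\<in>{1..n}. \<Sum>i\<in>{1..<j}. of_bool (norm (X i \<omega> - X j \<omega>) \<le> \<epsilon> n))"

definition Q_est :: "(nat \<Rightarrow> 'a \<Rightarrow> real^'d) \<Rightarrow> (nat \<Rightarrow> real) \<Rightarrow> nat \<Rightarrow> 'a \<Rightarrow> real" where
  "Q_est X \<epsilon> n \<omega> = N_est X \<epsilon> n \<omega> / real (n choose 2) / ball_vol CARD('d) (\<epsilon> n)"

definition H_est :: "(nat \<Rightarrow> 'a \<Rightarrow> real^'d) \<Rightarrow> (nat \<Rightarrow> real) \<Rightarrow> nat \<Rightarrow> 'a \<Rightarrow> real" where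
  "H_est X \<epsilon> n \<omega> = - ln (max (Q_est X \<epsilon> n \<omega>) (1 / real n))"

definition ennreal_sqrt :: "ennreal \<Rightarrow> ennreal" where
  "ennreal_sqrt y = (if y = \<infinity> then \<infinity> else ennreal (sqrt (enn2real y)))"

text \<open>
  The inner integral may be infinite for some \<open>(x\<^sub>1, x\<^sub>2)\<close>. A Bochner integral would be \<open>0\<close> there,
  so the partial norm takes values in \<^typ>\<open>ennreal\<close>.
\<close>

definition partial_L2_norm ::
    "('v::euclidean_space \<times> 'v \<times> 'v \<times> 'v \<Rightarrow> real) \<Rightarrow> 'v \<times> 'v \<Rightarrow> ennreal" where
  "partial_L2_norm f = (\<lambda>(x1, x2).
     ennreal_sqrt (\<integral>\<^sup>+ (x3, x4). ennreal ((f (x1, x2, x3, x4))\<^sup>2) \<partial>lborel))"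

definition assumption_A ::
    "'a measure \<Rightarrow> (nat \<Rightarrow> 'a \<Rightarrow> 'v::euclidean_space) \<Rightarrow> ('v \<Rightarrow> real) \<Rightarrow> bool" where
  "assumption_A M X p \<longleftrightarrow>
     in_L 3 p \<and>
     (\<forall>t1 t2 t3 t4. distinct [t1, t2, t3, t4] \<and> set [t1, t2, t3, t4] \<subseteq> {1..} \<longrightarrow>
        (\<exists>pt. (\<forall>z. 0 \<le> pt z) \<and>
              distributed M lborel (\<lambda>\<omega>. (X t1 \<omega>, X t2 \<omega>, X t3 \<omega>, X t4 \<omega>)) (\<lambda>z. ennreal (pt z)) \<and>
              partial_L2_norm pt \<in> borel_measurable lborel \<and>
              (\<integral>\<^sup>+ z. partial_L2_norm pt z \<partial>lborel) < \<infinity>))"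

end

theory Submission
  imports Defs
begin

text \<open>
  Write \<open>b\<close> for the volume of a ball of radius \<open>\<epsilon> n\<close>. The pairs \<open>i < j\<close> are split according to
  whether \<open>j - i\<close> exceeds \<open>m\<close>.

  For a far pair the two vectors are independent, so the pair is \<open>\<epsilon>\<close>-close with probability
  \<open>hit_prob = \<integral>\<integral> p(x) p(y) 1(\<bar>x - y\<bar> \<le> \<epsilon>)\<close>, and \<open>hit_prob / b \<longlonglongrightarrow> q2 p\<close> (\<open>hit_prob_asymp\<close>): the upper
  bound is \<open>2 p(x) p(y) \<le> p(x)\<^sup>2 + p(y)\<^sup>2\<close>, the lower bound follows by approximating \<open>p\<close> from below by
  simple functions. All but a proportion \<open>O(1/n)\<close> of the pairs are far, so the far pairs alone give
  the correct mean.

  The number of close far pairs concentrates (\<open>far_hits_second_moment\<close>). The covariance of two far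
  pairs is zero if no index of one is within \<open>m\<close> of an index of the other. If exactly one such
  coincidence occurs, which happens for \<open>O(n\<^sup>3)\<close> pairs of pairs, the other two vectors can be
  integrated out, and the joint probability is at most a multiple of
  \<open>\<integral> p(x) (\<integral> p(y) 1(\<bar>x - y\<bar> \<le> \<epsilon>) dy)\<^sup>2 dx\<close>, hence \<open>O(b\<^sup>2)\<close> because \<open>p\<close> is in \<open>L\<^sub>3\<close>.
  Two or more coincidences occur for only \<open>O(n\<^sup>2)\<close> pairs of pairs, where the bound \<open>hit_prob = O(b)\<close>
  is enough. After division by \<open>(n\<^sup>2 b)\<^sup>2\<close> the variance is \<open>O(1/n) + O(1/(n\<^sup>2 b))\<close>.

  There are at most \<open>n m\<close> near pairs, and their expected contribution to the estimator is of the order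
  of \<open>lag_prob / (n b)\<close>, where \<open>lag_prob\<close> is the probability that two vectors at a lag between \<open>1\<close> and
  \<open>m\<close> are close. This is the only place where the two parts of the theorem differ. In the second part the
  denominator stays away from zero, and \<open>lag_prob\<close> tends to zero since ties are null events. In
  the first part a pair at a short lag is combined with a far shifted copy of itself: the two are
  independent and equally likely to be close, so the probability that both are close is
  \<open>lag_prob\<^sup>2\<close>, while the Cauchy-Schwarz inequality and Assumption A bound it by a multiple of \<open>b\<close>
  (\<open>lag_prob_square_le\<close>). Thus \<open>lag_prob / (n b) = O(1 / sqrt (n\<^sup>2 b))\<close>.

  The statement for the entropy estimator follows from that for the quadratic functional by
  continuity of the logarithm at \<open>q2 p > 0\<close>.
\<close>

section \<open>The probability that two independent points are close\<close>

lemma ball_vol_eq_unit_ball_vol: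
  assumes "d > 0"
  shows "ball_vol d e = unit_ball_vol (real d) * e ^ d"
proof -
  have "Gamma (real d / 2 + 1) = real d / 2 * Gamma (real d / 2)"
    using assms by (intro Gamma_plus1) auto
  then show ?thesis
    unfolding ball_vol_def unit_ball_vol_def by (simp only: \<open>Gamma (real d / 2 + 1) = _\<close>) simp
qed

lemma emeasure_cball_ball_vol:
  fixes x :: "'v::euclidean_space"
  assumes "e \<ge> 0"
  shows "emeasure lborel (cball x e) = ennreal (ball_vol DIM('v) e)"
  using assms by (simp add: emeasure_cball ball_vol_eq_unit_ball_vol)

lemma ball_vol_pos:
  assumes "d > 0" "e > 0"
  shows "ball_vol d e > 0"
  using assms by (simp add: ball_vol_eq_unit_ball_vol)

text \<open>
  Values in the extended nonnegative reals, so that the kernel multiplies densities directly under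
  the nonnegative integral.
\<close>

definition near :: "real \<Rightarrow> 'v::euclidean_space \<Rightarrow> 'v \<Rightarrow> ennreal" where
  "near e x y = of_bool (norm (x - y) \<le> e)"

lemma near_commute: "near e x y = near e y x"
  by (simp add: near_def norm_minus_commute)

lemma near_measurable [measurable]:
  assumes [measurable]: "f \<in> borel_measurable N" "g \<in> borel_measurable N"
  shows "(\<lambda>z. near e (f z) (g z)) \<in> borel_measurable N"
  unfolding near_def by measurable

lemma nn_integral_near:
  fixes x :: "'v::euclidean_space"
  assumes "e \<ge> 0"
  shows "(\<integral>\<^sup>+ y. near e x y \<partial>lborel) = ennreal (ball_vol DIM('v) e)"
proof -
  have "near e x = indicator (cball x e)"
    by (auto simp: near_def fun_eq_iff dist_norm indicator_def)
  then show ?thesis using emeasure_cball_ball_vol[OF assms, of x] by simp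
qed

definition pair_mass :: "real \<Rightarrow> ('v::euclidean_space \<Rightarrow> ennreal) \<Rightarrow> ennreal" where
  "pair_mass e f = (\<integral>\<^sup>+ x. \<integral>\<^sup>+ y. f x * f y * near e x y \<partial>lborel \<partial>lborel)"

lemma nn_integral_near_weighted:
  fixes f :: "'v::euclidean_space \<Rightarrow> ennreal"
  assumes [measurable]: "f \<in> borel_measurable borel" and "e \<ge> 0"
  shows "(\<integral>\<^sup>+ x. \<integral>\<^sup>+ y. f x * near e x y \<partial>lborel \<partial>lborel) = ennreal (ball_vol DIM('v) e) * (\<integral>\<^sup>+ x. f x \<partial>lborel)"
    and "(\<integral>\<^sup>+ x. \<integral>\<^sup>+ y. f y * near e x y \<partial>lborel \<partial>lborel) = ennreal (ball_vol DIM('v) e) * (\<integral>\<^sup>+ x. f x \<partial>lborel)"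
proof -
  show 1: "(\<integral>\<^sup>+ x. \<integral>\<^sup>+ y. f x * near e x y \<partial>lborel \<partial>lborel) = ennreal (ball_vol DIM('v) e) * (\<integral>\<^sup>+ x. f x \<partial>lborel)"
    by (simp add: nn_integral_cmult nn_integral_near[OF \<open>e \<ge> 0\<close>] nn_integral_multc mult.commute)
  have "(\<integral>\<^sup>+ x. \<integral>\<^sup>+ y. f y * near e x y \<partial>lborel \<partial>lborel) = (\<integral>\<^sup>+ y. \<integral>\<^sup>+ x. f y * near e x y \<partial>lborel \<partial>lborel)"
    by (rule lborel_pair.Fubini') measurable
  also have "\<dots> = (\<integral>\<^sup>+ x. \<integral>\<^sup>+ y. f x * near e x y \<partial>lborel \<partial>lborel)"
    by (simp add: near_commute)
  finally show "(\<integral>\<^sup>+ x. \<integral>\<^sup>+ y. f y * near e x y \<partial>lborel \<partial>lborel) = ennreal (ball_vol DIM('v) e) * (\<integral>\<^sup>+ x. f x \<partial>lborel)"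
    using 1 by simp
qed

text \<open>
  Symmetrise with \<open>2 p(x) p(y) \<le> p(x)\<^sup>2 + p(y)\<^sup>2\<close>; each of the two terms then depends on one variable
  only, and the other one integrates to the volume of the ball.
\<close>

lemma pair_mass_le:
  fixes p :: "'v::euclidean_space \<Rightarrow> real"
  assumes [measurable]: "p \<in> borel_measurable borel" and p: "\<And>x. 0 \<le> p x" and "e \<ge> 0"
  shows "pair_mass e (\<lambda>x. ennreal (p x)) \<le> ennreal (ball_vol DIM('v) e) * (\<integral>\<^sup>+ x. ennreal ((p x)\<^sup>2) \<partial>lborel)"
proof -
  have "ennreal (p x) * ennreal (p y) * near e x y \<le> ennreal ((p x)\<^sup>2 / 2) * near e x y + ennreal ((p y)\<^sup>2 / 2) * near e x y" for x y
  proof -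
    have "p x * p y \<le> (p x)\<^sup>2 / 2 + (p y)\<^sup>2 / 2"
      using sum_squares_bound[of "p x" "p y"] by simp
    then have "ennreal (p x) * ennreal (p y) \<le> ennreal ((p x)\<^sup>2 / 2) + ennreal ((p y)\<^sup>2 / 2)"
      by (simp add: p ennreal_mult[symmetric] ennreal_plus[symmetric] del: ennreal_plus)
    then show ?thesis
      by (metis distrib_right mult_right_mono zero_le)
  qed
  then have "pair_mass e (\<lambda>x. ennreal (p x)) \<le>
      (\<integral>\<^sup>+ x. \<integral>\<^sup>+ y. ennreal ((p x)\<^sup>2 / 2) * near e x y + ennreal ((p y)\<^sup>2 / 2) * near e x y \<partial>lborel \<partial>lborel)"
    unfolding pair_mass_def by (intro nn_integral_mono)
  also have "\<dots> = (\<integral>\<^sup>+ x. \<integral>\<^sup>+ y. ennreal ((p x)\<^sup>2 / 2) * near e x y \<partial>lborel \<partial>lborel)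
      + (\<integral>\<^sup>+ x. \<integral>\<^sup>+ y. ennreal ((p y)\<^sup>2 / 2) * near e x y \<partial>lborel \<partial>lborel)"
    by (simp add: nn_integral_add)
  also have "\<dots> = ennreal (ball_vol DIM('v) e) * (\<integral>\<^sup>+ x. ennreal ((p x)\<^sup>2 / 2) + ennreal ((p x)\<^sup>2 / 2) \<partial>lborel)"
    by (simp add: nn_integral_near_weighted \<open>e \<ge> 0\<close> nn_integral_add distrib_left)
  also have "\<dots> = ennreal (ball_vol DIM('v) e) * (\<integral>\<^sup>+ x. ennreal ((p x)\<^sup>2) \<partial>lborel)"
    by (simp add: ennreal_plus[symmetric] del: ennreal_plus)
  finally show ?thesis .
qed

text \<open>
  After expanding the square, \<open>3 u v w \<le> u\<^sup>3 + v\<^sup>3 + w\<^sup>3\<close> separates the three densities. In each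
  term two of the three variables range over balls, which gives the square of the volume. This is
  where \<open>p \<in> L\<^sub>3\<close> enters the variance bound.
\<close>

lemma triple_mass_le:
  fixes p :: "'v::euclidean_space \<Rightarrow> real"
  assumes [measurable]: "p \<in> borel_measurable borel" and p: "\<And>x. 0 \<le> p x" and "e \<ge> 0"
  shows "(\<integral>\<^sup>+ x. ennreal (p x) * (\<integral>\<^sup>+ y. ennreal (p y) * near e x y \<partial>lborel)\<^sup>2 \<partial>lborel)
    \<le> (ennreal (ball_vol DIM('v) e))\<^sup>2 * (\<integral>\<^sup>+ x. ennreal (p x ^ 3) \<partial>lborel)"
    (is "?L \<le> ?b\<^sup>2 * ?I")
proof -
  let ?g = "\<lambda>x. ennreal (p x ^ 3 / 3)"
  let ?n = "\<lambda>x y z. near e x y * near e x z"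
  have young: "a * b * c \<le> (a ^ 3 + b ^ 3 + c ^ 3) / 3" if "0 \<le> a" "0 \<le> b" "0 \<le> c" for a b c :: real
  proof -
    have "a ^ 3 + b ^ 3 + c ^ 3 - 3 * a * b * c = (a + b + c) * ((a - b)\<^sup>2 + (b - c)\<^sup>2 + (a - c)\<^sup>2) / 2"
      by (simp add: field_simps power2_eq_square power3_eq_cube)
    also have "\<dots> \<ge> 0" using that by simp
    finally show ?thesis by simp
  qed
  have bd: "ennreal (p x) * (ennreal (p y) * near e x y) * (ennreal (p z) * near e x z)
      \<le> ?g x * near e x y * near e x z + ?g y * near e x y * near e x z + ?g z * near e x z * near e x y" for x y z
  proof -
    have "ennreal (p x) * ennreal (p y) * ennreal (p z) \<le> ?g x + ?g y + ?g z"
      using young[OF p p p, of x y z] p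
      by (simp add: ennreal_mult[symmetric] ennreal_plus[symmetric] add_divide_distrib del: ennreal_plus)
    then have "ennreal (p x) * ennreal (p y) * ennreal (p z) * ?n x y z \<le> (?g x + ?g y + ?g z) * ?n x y z"
      by (rule mult_right_mono) simp
    then show ?thesis by (simp add: algebra_simps)
  qed
  have "?L = (\<integral>\<^sup>+ x. \<integral>\<^sup>+ y. \<integral>\<^sup>+ z. ennreal (p x) * (ennreal (p y) * near e x y) * (ennreal (p z) * near e x z) \<partial>lborel \<partial>lborel \<partial>lborel)"
  proof (rule nn_integral_cong)
    fix x
    have "(\<integral>\<^sup>+ y. \<integral>\<^sup>+ z. ennreal (p x) * (ennreal (p y) * near e x y) * (ennreal (p z) * near e x z) \<partial>lborel \<partial>lborel)
        = (\<integral>\<^sup>+ y. ennreal (p x) * (ennreal (p y) * near e x y) * (\<integral>\<^sup>+ z. ennreal (p z) * near e x z \<partial>lborel) \<partial>lborel)"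
      by (intro nn_integral_cong nn_integral_cmult) measurable
    also have "\<dots> = (\<integral>\<^sup>+ y. ennreal (p x) * (ennreal (p y) * near e x y) \<partial>lborel) * (\<integral>\<^sup>+ z. ennreal (p z) * near e x z \<partial>lborel)"
      by (intro nn_integral_multc) measurable
    also have "(\<integral>\<^sup>+ y. ennreal (p x) * (ennreal (p y) * near e x y) \<partial>lborel) = ennreal (p x) * (\<integral>\<^sup>+ y. ennreal (p y) * near e x y \<partial>lborel)"
      by (intro nn_integral_cmult) measurable
    finally show "ennreal (p x) * (\<integral>\<^sup>+ y. ennreal (p y) * near e x y \<partial>lborel)\<^sup>2 =
      (\<integral>\<^sup>+ y. \<integral>\<^sup>+ z. ennreal (p x) * (ennreal (p y) * near e x y) * (ennreal (p z) * near e x z) \<partial>lborel \<partial>lborel)"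
      by (simp add: power2_eq_square mult.assoc)
  qed
  also have "\<dots> \<le> (\<integral>\<^sup>+ x. \<integral>\<^sup>+ y. \<integral>\<^sup>+ z. ?g x * near e x y * near e x z + ?g y * near e x y * near e x z + ?g z * near e x z * near e x y \<partial>lborel \<partial>lborel \<partial>lborel)"
    by (intro nn_integral_mono bd)
  also have "\<dots> = (\<integral>\<^sup>+ x. (?g x * ?b) * ?b + (\<integral>\<^sup>+ y. ?g y * near e x y \<partial>lborel) * ?b + (\<integral>\<^sup>+ z. ?g z * near e x z \<partial>lborel) * ?b \<partial>lborel)"
    by (simp add: nn_integral_add nn_integral_cmult nn_integral_multc nn_integral_near[OF \<open>e \<ge> 0\<close>])
  also have "\<dots> = (\<integral>\<^sup>+ x. ?g x \<partial>lborel) * ?b * ?b + ?b * (\<integral>\<^sup>+ x. ?g x \<partial>lborel) * ?b + ?b * (\<integral>\<^sup>+ x. ?g x \<partial>lborel) * ?b"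
    by (simp add: nn_integral_add nn_integral_multc nn_integral_near_weighted[OF _ \<open>e \<ge> 0\<close>])
  also have "\<dots> = ?b\<^sup>2 * ((\<integral>\<^sup>+ x. ?g x \<partial>lborel) + (\<integral>\<^sup>+ x. ?g x \<partial>lborel) + (\<integral>\<^sup>+ x. ?g x \<partial>lborel))"
    by (simp add: algebra_simps power2_eq_square)
  also have "(\<integral>\<^sup>+ x. ?g x \<partial>lborel) + (\<integral>\<^sup>+ x. ?g x \<partial>lborel) + (\<integral>\<^sup>+ x. ?g x \<partial>lborel) = ?I"
  proof -
    have "?g x + ?g x + ?g x = ennreal (p x ^ 3)" for x
      using p[of x] by (simp add: ennreal_plus[symmetric] del: ennreal_plus)
    then show ?thesis
      by (simp add: nn_integral_add[symmetric])
  qed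
  finally show ?thesis .
qed

text \<open>
  Enlarge \<open>A\<close> to an open set \<open>U\<close> with \<open>U - A\<close> small. Small balls around a point of \<open>A\<close> lie inside \<open>U\<close>,
  so with \<open>U\<close> in the place of the second copy of \<open>A\<close> the normalised integrand tends to \<open>1\<close> on \<open>A\<close> and
  Fatou's lemma applies. The replacement costs at most the measure of \<open>U - A\<close>, uniformly in the radius.
  This elementary argument takes the place of the Lebesgue differentiation theorem.
\<close>

lemma emeasure_le_liminf_pair_mass:
  fixes A :: "'v::euclidean_space set" and e :: "nat \<Rightarrow> real"
  assumes [measurable]: "A \<in> sets borel" and e: "\<forall>\<^sub>F n in sequentially. e n > 0" "e \<longlonglongrightarrow> 0"
  shows "emeasure lborel A \<le> liminf (\<lambda>n. pair_mass (e n) (indicator A) / ennreal (ball_vol DIM('v) (e n)))"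
proof (rule ennreal_le_epsilon)
  fix \<eta> :: real assume "\<eta> > 0"
  obtain U where U: "open U" "A \<subseteq> U" "emeasure lborel (U - A) \<le> \<eta>"
    using outer_regular_lborel_le[of A \<eta>] \<open>\<eta> > 0\<close> by auto
  have [measurable]: "U \<in> sets borel" using U by auto
  let ?b = "\<lambda>n. ennreal (ball_vol DIM('v) (e n))"
  let ?u = "\<lambda>n x. (\<integral>\<^sup>+ y. indicator A x * indicator U y * near (e n) x y \<partial>lborel) / ?b n"
  have b: "?b n \<noteq> 0 \<and> ?b n \<noteq> \<infinity>" if "e n > 0" for n
    using ball_vol_pos[OF _ that, of "DIM('v)"] by simp
  have lim: "indicator A x \<le> liminf (\<lambda>n. ?u n x)" for x
  proof (cases "x \<in> A")
    case True
    then obtain r where r: "r > 0" "cball x r \<subseteq> U"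
      using U by (meson open_contains_cball subsetD)
    have "\<forall>\<^sub>F n in sequentially. e n < r"
      using e(2) r(1) by (auto dest: order_tendstoD)
    then have "\<forall>\<^sub>F n in sequentially. 1 \<le> ?u n x"
      using e(1)
    proof eventually_elim
      case (elim n)
      have "indicator A x * indicator U y * near (e n) x y = near (e n) x y" for y
      proof (cases "norm (x - y) \<le> e n")
        case True
        with elim have "y \<in> cball x r" by (simp add: dist_norm)
        with r \<open>x \<in> A\<close> show ?thesis by auto
      qed (simp add: near_def)
      then show ?case
        using elim b[of n] by (simp add: nn_integral_near ennreal_divide_self)
    qed
    then show ?thesis using True by (simp add: Liminf_bounded)
  qed simp
  have "emeasure lborel A = (\<integral>\<^sup>+ x. indicator A x \<partial>lborel)" by simp
  also have "\<dots> \<le> (\<integral>\<^sup>+ x. liminf (\<lambda>n. ?u n x) \<partial>lborel)"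
    by (intro nn_integral_mono lim)
  also have "\<dots> \<le> liminf (\<lambda>n. \<integral>\<^sup>+ x. ?u n x \<partial>lborel)"
    by (rule nn_integral_liminf) measurable
  also have "\<dots> \<le> liminf (\<lambda>n. pair_mass (e n) (indicator A) / ?b n + ennreal \<eta>)"
  proof (rule Liminf_mono)
    show "\<forall>\<^sub>F n in sequentially. (\<integral>\<^sup>+ x. ?u n x \<partial>lborel) \<le> pair_mass (e n) (indicator A) / ?b n + ennreal \<eta>"
      using e(1)
    proof eventually_elim
      case (elim n)
      have "indicator A x * indicator U y * near (e n) x y
          \<le> indicator A x * indicator A y * near (e n) x y + indicator (U - A) y * near (e n) x y" for x y
        by (auto simp: indicator_def)
      then have "(\<integral>\<^sup>+ x. \<integral>\<^sup>+ y. indicator A x * indicator U y * near (e n) x y \<partial>lborel \<partial>lborel)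
         \<le> (\<integral>\<^sup>+ x. \<integral>\<^sup>+ y. indicator A x * indicator A y * near (e n) x y + indicator (U - A) y * near (e n) x y \<partial>lborel \<partial>lborel)"
        by (intro nn_integral_mono)
      also have "\<dots> = pair_mass (e n) (indicator A) + ?b n * emeasure lborel (U - A)"
        using elim by (simp add: nn_integral_add pair_mass_def nn_integral_near_weighted)
      also have "\<dots> \<le> pair_mass (e n) (indicator A) + ?b n * ennreal \<eta>"
        using U(3) by (intro add_left_mono mult_left_mono) auto
      finally have "(\<integral>\<^sup>+ x. \<integral>\<^sup>+ y. indicator A x * indicator U y * near (e n) x y \<partial>lborel \<partial>lborel) / ?b n
         \<le> (pair_mass (e n) (indicator A) + ?b n * ennreal \<eta>) / ?b n"
        by (rule divide_right_mono_ennreal)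
      also have "\<dots> = pair_mass (e n) (indicator A) / ?b n + ennreal \<eta>"
      proof -
        have "ennreal \<eta> * ?b n / ?b n = ennreal \<eta>"
          using b[OF elim] by (intro ennreal_mult_divide_eq) auto
        then show ?thesis
          by (simp add: divide_ennreal_def algebra_simps)
      qed
      finally show ?case by (simp add: nn_integral_divide)
    qed
  qed
  also have "\<dots> = liminf (\<lambda>n. pair_mass (e n) (indicator A) / ?b n) + ennreal \<eta>"
    by (rule Liminf_add_const) auto
  finally show "emeasure lborel A \<le> liminf (\<lambda>n. pair_mass (e n) (indicator A) / ?b n) + ennreal \<eta>" .
qed

text \<open>
  Keeping only the pairs of points in the same level set of \<open>g\<close> can only decrease the pair mass and
  reduces the claim to indicators. The limit inferior passes through the finite sum over the levels
  by Fatou's lemma for the discrete measure with weights \<open>c * c\<close>.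
\<close>

lemma liminf_pair_mass_simple:
  fixes g :: "'v::euclidean_space \<Rightarrow> ennreal" and e :: "nat \<Rightarrow> real"
  assumes g: "simple_function borel g"
    and e: "\<forall>\<^sub>F n in sequentially. e n > 0" "e \<longlonglongrightarrow> 0"
  shows "(\<integral>\<^sup>+ x. g x * g x \<partial>lborel) \<le> liminf (\<lambda>n. pair_mass (e n) g / ennreal (ball_vol DIM('v) (e n)))"
proof -
  let ?b = "\<lambda>n. ennreal (ball_vol DIM('v) (e n))"
  let ?C = "range g" and ?A = "\<lambda>c. g -` {c}"
  have fin: "finite ?C" using simple_functionD(1)[OF g] by simp
  have [measurable]: "?A c \<in> sets borel" for c
    using simple_functionD(2)[OF g, of "{c}"] by simp
  have [measurable]: "g \<in> borel_measurable borel"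
    using g by (rule borel_measurable_simple_function)
  \<comment> \<open>Only the level \<open>c = g x\<close> contributes, and it does so only if \<open>g y = g x\<close>.\<close>
  have sq: "g x * g y \<ge> (\<Sum>c\<in>?C. c * c * (indicator (?A c) x * indicator (?A c) y))" for x y
  proof -
    have "(\<Sum>c\<in>?C. c * c * (indicator (?A c) x * indicator (?A c) y)) =
        (\<Sum>c\<in>?C. if c = g x then c * c * indicator {g x} (g y) else 0)"
      by (intro sum.cong) (auto simp: indicator_def)
    also have "\<dots> = g x * g x * indicator {g x} (g y)" using fin by simp
    also have "\<dots> \<le> g x * g y" by (auto simp: indicator_def)
    finally show ?thesis .
  qed
  have sq_eq: "g x * g x = (\<Sum>c\<in>?C. c * c * indicator (?A c) x)" for x
  proof -
    have "(\<Sum>c\<in>?C. c * c * indicator (?A c) x) = (\<Sum>c\<in>?C. if c = g x then c * c else 0)"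
      by (intro sum.cong) (auto simp: indicator_def)
    then show ?thesis using fin by simp
  qed
  have "(\<integral>\<^sup>+ x. g x * g x \<partial>lborel) = (\<Sum>c\<in>?C. c * c * emeasure lborel (?A c))"
    by (simp add: sq_eq nn_integral_sum nn_integral_cmult_indicator)
  also have "\<dots> \<le> (\<Sum>c\<in>?C. c * c * liminf (\<lambda>n. pair_mass (e n) (indicator (?A c)) / ?b n))"
    by (intro sum_mono mult_left_mono emeasure_le_liminf_pair_mass e) auto
  also have "\<dots> = (\<integral>\<^sup>+ c. liminf (\<lambda>n. pair_mass (e n) (indicator (?A c)) / ?b n) \<partial>point_measure ?C (\<lambda>c. c * c))"
    using fin by (simp add: nn_integral_point_measure_finite)
  also have "\<dots> \<le> liminf (\<lambda>n. \<integral>\<^sup>+ c. pair_mass (e n) (indicator (?A c)) / ?b n \<partial>point_measure ?C (\<lambda>c. c * c))"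
    by (rule nn_integral_liminf) (simp add: measurable_point_measure_eq1)
  also have "\<dots> = liminf (\<lambda>n. \<Sum>c\<in>?C. c * c * (pair_mass (e n) (indicator (?A c)) / ?b n))"
    using fin by (simp add: nn_integral_point_measure_finite)
  also have "\<dots> \<le> liminf (\<lambda>n. pair_mass (e n) g / ?b n)"
  proof (intro Liminf_mono always_eventually allI)
    fix n
    have "(\<Sum>c\<in>?C. c * c * pair_mass (e n) (indicator (?A c)))
        = (\<integral>\<^sup>+ x. \<integral>\<^sup>+ y. (\<Sum>c\<in>?C. c * c * (indicator (?A c) x * indicator (?A c) y * near (e n) x y)) \<partial>lborel \<partial>lborel)"
      by (simp add: pair_mass_def nn_integral_cmult nn_integral_sum)
    also have "\<dots> \<le> pair_mass (e n) g"
      unfolding pair_mass_def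
    proof (intro nn_integral_mono)
      fix x y
      show "(\<Sum>c\<in>?C. c * c * (indicator (?A c) x * indicator (?A c) y * near (e n) x y)) \<le> g x * g y * near (e n) x y"
        using mult_right_mono[OF sq[of x y], of "near (e n) x y"]
        by (simp add: sum_distrib_right mult.assoc)
    qed
    finally have "(\<Sum>c\<in>?C. c * c * pair_mass (e n) (indicator (?A c))) / ?b n \<le> pair_mass (e n) g / ?b n"
      by (rule divide_right_mono_ennreal)
    then show "(\<Sum>c\<in>?C. c * c * (pair_mass (e n) (indicator (?A c)) / ?b n)) \<le> pair_mass (e n) g / ?b n"
      by (simp add: divide_ennreal_def sum_distrib_right mult.assoc)
  qed
  finally show ?thesis .
qed

text \<open>
  The pair mass is monotone in the density, so it dominates that of every simple function below \<open>f\<close>.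
\<close>

lemma liminf_pair_mass:
  fixes f :: "'v::euclidean_space \<Rightarrow> ennreal" and e :: "nat \<Rightarrow> real"
  assumes [measurable]: "f \<in> borel_measurable borel"
    and e: "\<forall>\<^sub>F n in sequentially. e n > 0" "e \<longlonglongrightarrow> 0"
  shows "(\<integral>\<^sup>+ x. f x * f x \<partial>lborel) \<le> liminf (\<lambda>n. pair_mass (e n) f / ennreal (ball_vol DIM('v) (e n)))"
proof -
  obtain g where g: "\<And>i. simple_function borel (g i)" "incseq g" "\<And>x. (SUP i. g i x) = f x"
    by (rule borel_measurable_implies_simple_function_sequence'[OF assms(1)]) (rule that; assumption)
  have [measurable]: "g i \<in> borel_measurable borel" for i
    using g(1) by (rule borel_measurable_simple_function)
  have mono: "g i x \<le> g j x" if "i \<le> j" for i j x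
    using g(2) that by (auto simp: incseq_def le_fun_def)
  have lim: "(\<lambda>i. g i x) \<longlonglongrightarrow> f x" for x
    using LIMSEQ_SUP[of "\<lambda>i. g i x"] mono by (simp add: g(3) incseq_def)
  have "(\<lambda>i. \<integral>\<^sup>+ x. g i x * g i x \<partial>lborel) \<longlonglongrightarrow> (\<integral>\<^sup>+ x. f x * f x \<partial>lborel)"
  proof (rule nn_integral_LIMSEQ)
    show "incseq (\<lambda>i x. g i x * g i x)"
      by (auto simp: incseq_def le_fun_def intro!: mult_mono mono)
    show "(\<lambda>i. g i x * g i x) \<longlonglongrightarrow> f x * f x" for x
      by (intro tendsto_mult_ennreal lim) auto
  qed measurable
  moreover have "(\<integral>\<^sup>+ x. g i x * g i x \<partial>lborel) \<le> liminf (\<lambda>n. pair_mass (e n) f / ennreal (ball_vol DIM('v) (e n)))" for i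
  proof -
    have "g i x \<le> f x" for x by (subst g(3)[symmetric]) (rule SUP_upper, simp)
    then have "pair_mass (e n) (g i) \<le> pair_mass (e n) f" for n
      unfolding pair_mass_def by (intro nn_integral_mono mult_mono) auto
    then show ?thesis
      by (intro order_trans[OF liminf_pair_mass_simple[OF g(1) e]] Liminf_mono always_eventually allI divide_right_mono_ennreal)
  qed
  ultimately show ?thesis
    by (intro LIMSEQ_le_const2) auto
qed

section \<open>Independence of isolated indices\<close>

locale m_dependent_sample = prob_space M
  for M :: "'a measure" +
  fixes X :: "nat \<Rightarrow> 'a \<Rightarrow> 'v::euclidean_space" and p :: "'v \<Rightarrow> real" and m :: nat
  assumes stationary: "strictly_stationary M X"
    and m_dep: "m_dependent M m X"
    and p_nonneg: "\<And>x. 0 \<le> p x"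
    and X_density: "\<And>i. i \<ge> 1 \<Longrightarrow> distributed M lborel (X i) (\<lambda>x. ennreal (p x))"
    and p_L2: "in_L 2 p"
begin

definition far :: "nat \<Rightarrow> nat \<Rightarrow> bool" where
  "far i j \<longleftrightarrow> i + m < j \<or> j + m < i"

definition close_event :: "real \<Rightarrow> nat \<Rightarrow> nat \<Rightarrow> 'a set" where
  "close_event e i j = {\<omega> \<in> space M. norm (X i \<omega> - X j \<omega>) \<le> e}"

definition smoothed :: "real \<Rightarrow> 'v \<Rightarrow> ennreal" where
  "smoothed e x = (\<integral>\<^sup>+ y. ennreal (p y) * near e x y \<partial>lborel)"

lemma p_measurable [measurable]: "p \<in> borel_measurable borel"
  using p_L2 by (simp add: in_L_def)

lemma X_measurable [measurable]: "i \<ge> 1 \<Longrightarrow> X i \<in> borel_measurable M"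
  using stationary by (simp add: strictly_stationary_def)

lemma smoothed_measurable [measurable]: "smoothed e \<in> borel_measurable borel"
  unfolding smoothed_def by measurable

lemma close_event_measurable [measurable]:
  assumes "i \<ge> 1" "j \<ge> 1"
  shows "close_event e i j \<in> events"
  using assms unfolding close_event_def by measurable

text \<open>
  The hypothesis of \<open>m\<close>-dependence speaks of two blocks of consecutive indices. Arbitrary index sets
  separated by a gap larger than \<open>m\<close> embed in such blocks, with no constraint at the extra indices.
\<close>

lemma prob_separated_rectangles:
  assumes S: "finite S" "S \<subseteq> {1..}" and T: "finite T" "T \<subseteq> {1..}"
    and gap: "\<And>s t. s \<in> S \<Longrightarrow> t \<in> T \<Longrightarrow> s + m < t"
    and A: "\<And>s. A s \<in> sets borel"
  shows "prob {\<omega> \<in> space M. \<forall>s\<in>S \<union> T. X s \<omega> \<in> A s} =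
    prob {\<omega> \<in> space M. \<forall>s\<in>S. X s \<omega> \<in> A s} * prob {\<omega> \<in> space M. \<forall>s\<in>T. X s \<omega> \<in> A s}"
proof (cases "S = {} \<or> T = {}")
  case True
  then show ?thesis by (auto simp: prob_space)
next
  case False
  define a where "a = Max S"
  define b where "b = Min T"
  define r where "r = a - 1"
  define s where "s = Max T - b"
  have a: "a \<in> S" "\<And>x. x \<in> S \<Longrightarrow> x \<le> a" using S False by (auto simp: a_def)
  have b: "b \<in> T" "\<And>x. x \<in> T \<Longrightarrow> b \<le> x" using T False by (auto simp: b_def)
  have "b \<le> Max T" "\<And>x. x \<in> T \<Longrightarrow> x \<le> Max T" using T b by auto
  then have Tsub: "T \<subseteq> {b..b + s}" using b by (auto simp: s_def)
  have Ssub: "S \<subseteq> {a - r..a}" using a S by (auto simp: r_def)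
  have "r < a" using a S by (auto simp: r_def)
  let ?XS = "\<lambda>\<omega>. \<lambda>i\<in>{a - r..a}. X i \<omega>" and ?XT = "\<lambda>\<omega>. \<lambda>i\<in>{b..b + s}. X i \<omega>"
  let ?ES = "Pi\<^sub>E {a - r..a} (\<lambda>i. if i \<in> S then A i else UNIV)"
  let ?ET = "Pi\<^sub>E {b..b + s} (\<lambda>i. if i \<in> T then A i else UNIV)"
  have "indep_var (PiM {a - r..a} (\<lambda>_. borel)) ?XS (PiM {b..b + s} (\<lambda>_. borel)) ?XT"
    using m_dep \<open>r < a\<close> gap[OF a(1) b(1)] by (simp add: m_dependent_def)
  then have "prob ((\<lambda>x. (?XS x, ?XT x)) -` (?ES \<times> ?ET) \<inter> space M) = prob (?XS -` ?ES \<inter> space M) * prob (?XT -` ?ET \<inter> space M)"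
  proof (rule indep_varD)
    show "?ES \<in> sets (PiM {a - r..a} (\<lambda>_. borel))" by (rule sets_PiM_I_finite) (use A in auto)
    show "?ET \<in> sets (PiM {b..b + s} (\<lambda>_. borel))" by (rule sets_PiM_I_finite) (use A in auto)
  qed
  also have "?XS -` ?ES \<inter> space M = {\<omega> \<in> space M. \<forall>s\<in>S. X s \<omega> \<in> A s}"
    using Ssub by (auto simp: PiE_iff split: if_splits)
  also have "?XT -` ?ET \<inter> space M = {\<omega> \<in> space M. \<forall>s\<in>T. X s \<omega> \<in> A s}"
    using Tsub by (auto simp: PiE_iff split: if_splits)
  also have "(\<lambda>x. (?XS x, ?XT x)) -` (?ES \<times> ?ET) \<inter> space M = {\<omega> \<in> space M. \<forall>s\<in>S \<union> T. X s \<omega> \<in> A s}"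
    using Ssub Tsub by (auto simp: PiE_iff split: if_splits)
  finally show ?thesis .
qed

text \<open>
  \<open>S\<close> may have elements on both sides of \<open>a\<close>, so this is not one instance of \<open>m\<close>-dependence. On
  rectangles, the part of \<open>S\<close> above \<open>a\<close> is separated from \<open>a\<close> and the part below, and the latter two
  from each other; three applications of the product formula factor out the event at \<open>a\<close>. Rectangles
  are stable under intersection and generate the product sigma algebra.
\<close>

lemma isolated_joint_distr:
  assumes S: "finite S" "S \<subseteq> {1..}" and "a \<ge> 1" and far: "\<And>s. s \<in> S \<Longrightarrow> far s a"
  shows "distr M (PiM S (\<lambda>_. borel)) (\<lambda>\<omega>. \<lambda>i\<in>S. X i \<omega>) \<Otimes>\<^sub>M distr M borel (X a) =
    distr M (PiM S (\<lambda>_. borel) \<Otimes>\<^sub>M borel) (\<lambda>\<omega>. (\<lambda>i\<in>S. X i \<omega>, X a \<omega>))"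
proof -
  let ?XS = "\<lambda>\<omega>. \<lambda>i\<in>S. X i \<omega>"
  let ?N = "PiM S (\<lambda>_. borel :: 'v measure)"
  let ?G = "{?XS -` E \<inter> space M | E. E \<in> prod_algebra S (\<lambda>_. borel :: 'v measure)}"
  let ?H = "{X a -` B \<inter> space M | B. B \<in> sets borel}"
  have Xa [measurable]: "X a \<in> borel_measurable M"
    using \<open>a \<ge> 1\<close> by (rule X_measurable)
  have XS [measurable]: "?XS \<in> measurable M ?N"
    using S by (intro measurable_restrict) (auto intro: X_measurable)
  have gen: "{?XS -` E \<inter> space M | E. E \<in> sets ?N} = sigma_sets (space M) ?G"
    unfolding sets_PiM by (rule sigma_sets_vimage_commute) auto
  have ev: "?G \<subseteq> events" "?H \<subseteq> events"
    using measurable_sets[OF XS] measurable_sets[OF X_measurable[OF \<open>a \<ge> 1\<close>]]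
    by (auto simp: sets_PiM)
  have "indep_set ?G ?H"
    unfolding indep_sets2_eq
  proof (intro conjI ev ballI)
    fix E' B' assume "E' \<in> ?G" "B' \<in> ?H"
    then obtain E B where EB: "E' = ?XS -` E \<inter> space M" "B' = X a -` B \<inter> space M"
      "E \<in> prod_algebra S (\<lambda>_. borel :: 'v measure)" "B \<in> sets borel" by auto
    obtain A where A: "E = Pi\<^sub>E S A" "\<And>s. s \<in> S \<Longrightarrow> A s \<in> sets (borel :: 'v measure)"
      using EB(3) S(1) by (auto simp: prod_algebra_eq_finite)
    define A' where "A' = (\<lambda>s. if s = a then B else if s \<in> S then A s else UNIV)"
    have A': "A' s \<in> sets borel" for s using A EB by (auto simp: A'_def)
    define ev where "ev T = {\<omega> \<in> space M. \<forall>s\<in>T. X s \<omega> \<in> A' s}" for T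
    define S1 where "S1 = {s\<in>S. s + m < a}"
    define S2 where "S2 = {s\<in>S. a + m < s}"
    have S12: "S = S1 \<union> S2" "a \<notin> S" using far by (auto simp: S1_def S2_def far_def)
    have prod: "prob (ev (U \<union> V)) = prob (ev U) * prob (ev V)"
      if "U \<subseteq> insert a S" "V \<subseteq> insert a S" "\<And>s t. s \<in> U \<Longrightarrow> t \<in> V \<Longrightarrow> s + m < t" for U V
      unfolding ev_def using that S \<open>a \<ge> 1\<close> A'
      by (intro prob_separated_rectangles) (auto intro: finite_subset)
    have sub: "S1 \<subseteq> insert a S" "S2 \<subseteq> insert a S" "{a} \<subseteq> insert a S" "S1 \<union> {a} \<subseteq> insert a S"
      by (auto simp: S1_def S2_def)
    have "prob (ev ((S1 \<union> {a}) \<union> S2)) = prob (ev (S1 \<union> {a})) * prob (ev S2)"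
      by (intro prod sub) (auto simp: S1_def S2_def)
    also have "prob (ev (S1 \<union> {a})) = prob (ev S1) * prob (ev {a})"
      by (intro prod sub) (auto simp: S1_def S2_def)
    also have "prob (ev S1) * prob (ev {a}) * prob (ev S2) = prob (ev (S1 \<union> S2)) * prob (ev {a})"
      by (subst prod) (auto simp: S1_def S2_def)
    finally have *: "prob (ev (S1 \<union> {a} \<union> S2)) = prob (ev (S1 \<union> S2)) * prob (ev {a})" .
    have "E' = ev (S1 \<union> S2)"
      unfolding S12(1)[symmetric] ev_def EB A using S12(2) by (auto simp: A'_def PiE_iff split: if_splits)
    moreover have "B' = ev {a}" by (auto simp: ev_def EB A'_def)
    moreover have "ev (S1 \<union> {a} \<union> S2) = ev (S1 \<union> S2) \<inter> ev {a}" by (auto simp: ev_def)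
    ultimately show "prob (E' \<inter> B') = prob E' * prob B'" using * by simp
  qed
  moreover have "Int_stable ?G"
  proof (rule Int_stableI)
    fix u v assume "u \<in> ?G" "v \<in> ?G"
    then obtain E F where "u = ?XS -` E \<inter> space M" "v = ?XS -` F \<inter> space M"
      "E \<in> prod_algebra S (\<lambda>_. borel :: 'v measure)" "F \<in> prod_algebra S (\<lambda>_. borel :: 'v measure)" by auto
    then show "u \<inter> v \<in> ?G"
      using Int_stable_prod_algebra[of S "\<lambda>_. borel :: 'v measure"]
      by (auto simp: Int_stable_def intro!: exI[of _ "E \<inter> F"])
  qed
  moreover have "Int_stable ?H"
  proof (rule Int_stableI)
    fix u v assume "u \<in> ?H" "v \<in> ?H"
    then obtain E F where "u = X a -` E \<inter> space M" "v = X a -` F \<inter> space M" "E \<in> sets borel" "F \<in> sets borel" by auto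
    then show "u \<inter> v \<in> ?H" by (auto intro!: exI[of _ "E \<inter> F"])
  qed
  ultimately have indep: "indep_set (sigma_sets (space M) ?G) (sigma_sets (space M) ?H)"
    by (rule indep_set_sigma_sets)
  interpret XS: prob_space "distr M ?N ?XS" by (rule prob_space_distr) fact
  interpret Xa: prob_space "distr M borel (X a)" by (rule prob_space_distr) fact
  show ?thesis
  proof (rule pair_measure_eqI)
    show "sigma_finite_measure (distr M ?N ?XS)" "sigma_finite_measure (distr M borel (X a))" ..
    fix E B assume "E \<in> sets (distr M ?N ?XS)" and "B \<in> sets (distr M borel (X a))"
    then have [measurable]: "E \<in> sets ?N" "B \<in> sets borel" by auto
    have "prob ((?XS -` E \<inter> space M) \<inter> (X a -` B \<inter> space M)) = prob (?XS -` E \<inter> space M) * prob (X a -` B \<inter> space M)"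
      by (rule indep_setD[OF indep]) (auto simp: gen[symmetric] intro!: sigma_sets.Basic)
    moreover have "(\<lambda>\<omega>. (?XS \<omega>, X a \<omega>)) -` (E \<times> B) \<inter> space M = (?XS -` E \<inter> space M) \<inter> (X a -` B \<inter> space M)"
      by auto
    ultimately show "emeasure (distr M ?N ?XS) E * emeasure (distr M borel (X a)) B =
        emeasure (distr M (?N \<Otimes>\<^sub>M borel) (\<lambda>\<omega>. (?XS \<omega>, X a \<omega>))) (E \<times> B)"
      by (simp add: emeasure_distr emeasure_eq_measure ennreal_mult[symmetric])
  qed simp
qed

text \<open>
  The working form of independence: the vector at an isolated index is integrated out against \<open>p\<close>
  while the others stay random. The function \<open>G\<close> takes a whole family of points so that a statement
  about two, three or four indices is an instance with \<open>S\<close> an explicit finite set.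
\<close>

lemma nn_integral_isolated:
  assumes S: "finite S" "S \<subseteq> {1..}" and a: "a \<ge> 1" and far: "\<And>s. s \<in> S \<Longrightarrow> far s a"
    and G [measurable]: "(\<lambda>(z, y). G z y) \<in> borel_measurable (PiM S (\<lambda>_. borel) \<Otimes>\<^sub>M borel)"
    and dep: "\<And>z y. G (restrict z S) y = G z y"
  shows "(\<integral>\<^sup>+ \<omega>. G (\<lambda>i. X i \<omega>) (X a \<omega>) \<partial>M) =
    (\<integral>\<^sup>+ \<omega>. \<integral>\<^sup>+ y. ennreal (p y) * G (\<lambda>i. X i \<omega>) y \<partial>lborel \<partial>M)"
proof -
  let ?XS = "\<lambda>\<omega>. \<lambda>i\<in>S. X i \<omega>"
  let ?N = "PiM S (\<lambda>_. borel :: 'v measure)"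
  have Xa [measurable]: "X a \<in> borel_measurable M"
    using a by (rule X_measurable)
  have XS [measurable]: "?XS \<in> measurable M ?N"
    using S by (intro measurable_restrict) (auto intro: X_measurable)
  interpret XS: prob_space "distr M ?N ?XS" by (rule prob_space_distr) fact
  interpret Xa: prob_space "distr M borel (X a)" by (rule prob_space_distr) fact
  interpret pair_sigma_finite "distr M ?N ?XS" "distr M borel (X a)" ..
  have "(\<integral>\<^sup>+ \<omega>. G (\<lambda>i. X i \<omega>) (X a \<omega>) \<partial>M) = (\<integral>\<^sup>+ \<omega>. (\<lambda>(z, y). G z y) (?XS \<omega>, X a \<omega>) \<partial>M)"
    by (simp add: dep)
  also have "\<dots> = (\<integral>\<^sup>+ w. (\<lambda>(z, y). G z y) w \<partial>distr M (?N \<Otimes>\<^sub>M borel) (\<lambda>\<omega>. (?XS \<omega>, X a \<omega>)))"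
    by (subst nn_integral_distr) auto
  also have "\<dots> = (\<integral>\<^sup>+ w. (\<lambda>(z, y). G z y) w \<partial>(distr M ?N ?XS \<Otimes>\<^sub>M distr M borel (X a)))"
    by (subst isolated_joint_distr) (use assms in auto)
  also have "\<dots> = (\<integral>\<^sup>+ z. \<integral>\<^sup>+ y. G z y \<partial>distr M borel (X a) \<partial>distr M ?N ?XS)"
    by (subst Xa.nn_integral_fst[symmetric]) auto
  also have "\<dots> = (\<integral>\<^sup>+ z. \<integral>\<^sup>+ y. ennreal (p y) * G z y \<partial>lborel \<partial>distr M ?N ?XS)"
  proof (rule nn_integral_cong)
    fix z assume "z \<in> space (distr M ?N ?XS)"
    then have z: "z \<in> space ?N" by simp
    have [measurable]: "G z \<in> borel_measurable borel"
      using measurable_compose[OF measurable_Pair1'[OF z] G] by simp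
    have "(\<integral>\<^sup>+ y. G z y \<partial>distr M borel (X a)) = (\<integral>\<^sup>+ \<omega>. G z (X a \<omega>) \<partial>M)"
      by (simp add: nn_integral_distr)
    also have "\<dots> = (\<integral>\<^sup>+ y. ennreal (p y) * G z y \<partial>lborel)"
      by (rule distributed_nn_integral[OF X_density[OF a], symmetric]) simp
    finally show "(\<integral>\<^sup>+ y. G z y \<partial>distr M borel (X a)) = (\<integral>\<^sup>+ y. ennreal (p y) * G z y \<partial>lborel)" .
  qed
  also have "\<dots> = (\<integral>\<^sup>+ \<omega>. \<integral>\<^sup>+ y. ennreal (p y) * G (?XS \<omega>) y \<partial>lborel \<partial>M)"
    by (subst nn_integral_distr) auto
  finally show ?thesis by (simp add: dep)
qed

lemma nn_integral_X:
  assumes "i \<ge> 1" "f \<in> borel_measurable borel"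
  shows "(\<integral>\<^sup>+ \<omega>. f (X i \<omega>) \<partial>M) = (\<integral>\<^sup>+ x. ennreal (p x) * f x \<partial>lborel)"
  using distributed_nn_integral[OF X_density[OF assms(1)], of f] assms(2) by simp

lemma pair_mass_eq_smoothed:
  "pair_mass e (\<lambda>x. ennreal (p x)) = (\<integral>\<^sup>+ x. ennreal (p x) * smoothed e x \<partial>lborel)"
  unfolding pair_mass_def smoothed_def
  by (simp add: mult.assoc nn_integral_cmult)

lemma far_commute: "far i j \<longleftrightarrow> far j i"
  by (auto simp: far_def)

lemma nn_integral_near_far:
  assumes "i \<ge> 1" "j \<ge> 1" "far i j"
  shows "(\<integral>\<^sup>+ \<omega>. near e (X i \<omega>) (X j \<omega>) \<partial>M) = pair_mass e (\<lambda>x. ennreal (p x))"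
proof -
  have "(\<integral>\<^sup>+ \<omega>. near e (X i \<omega>) (X j \<omega>) \<partial>M) = (\<integral>\<^sup>+ \<omega>. \<integral>\<^sup>+ y. ennreal (p y) * near e (X i \<omega>) y \<partial>lborel \<partial>M)"
    using assms by (intro nn_integral_isolated[where S = "{i}" and G = "\<lambda>z y. near e (z i) y"]) auto
  also have "\<dots> = (\<integral>\<^sup>+ \<omega>. smoothed e (X i \<omega>) \<partial>M)" by (simp add: smoothed_def)
  finally show ?thesis
    using assms by (simp add: nn_integral_X pair_mass_eq_smoothed)
qed

lemma nn_integral_near_near:
  assumes ge: "i \<ge> 1" "j \<ge> 1" "k \<ge> 1" "l \<ge> 1" and far: "far i j" "far k j" "far l j"
  shows "(\<integral>\<^sup>+ \<omega>. near e (X i \<omega>) (X j \<omega>) * near e (X k \<omega>) (X l \<omega>) \<partial>M) =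
    (\<integral>\<^sup>+ \<omega>. smoothed e (X i \<omega>) * near e (X k \<omega>) (X l \<omega>) \<partial>M)"
proof -
  have "(\<integral>\<^sup>+ \<omega>. near e (X i \<omega>) (X j \<omega>) * near e (X k \<omega>) (X l \<omega>) \<partial>M) =
     (\<integral>\<^sup>+ \<omega>. \<integral>\<^sup>+ y. ennreal (p y) * (near e (X i \<omega>) y * near e (X k \<omega>) (X l \<omega>)) \<partial>lborel \<partial>M)"
    using assms
    by (intro nn_integral_isolated[where S = "{i, k, l}" and G = "\<lambda>z y. near e (z i) y * near e (z k) (z l)"]) auto
  also have "\<dots> = (\<integral>\<^sup>+ \<omega>. smoothed e (X i \<omega>) * near e (X k \<omega>) (X l \<omega>) \<partial>M)"
    by (simp add: smoothed_def mult.assoc[symmetric] nn_integral_multc)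
  finally show ?thesis .
qed

lemma nn_integral_near_near_all_far:
  assumes ge: "i \<ge> 1" "j \<ge> 1" "k \<ge> 1" "l \<ge> 1"
    and far: "far i j" "far k j" "far l j" "far k i" "far l i" "far k l"
  shows "(\<integral>\<^sup>+ \<omega>. near e (X i \<omega>) (X j \<omega>) * near e (X k \<omega>) (X l \<omega>) \<partial>M) = (pair_mass e (\<lambda>x. ennreal (p x)))\<^sup>2"
proof -
  have "(\<integral>\<^sup>+ \<omega>. near e (X i \<omega>) (X j \<omega>) * near e (X k \<omega>) (X l \<omega>) \<partial>M) =
     (\<integral>\<^sup>+ \<omega>. smoothed e (X i \<omega>) * near e (X k \<omega>) (X l \<omega>) \<partial>M)"
    using assms by (intro nn_integral_near_near)
  also have "\<dots> = (\<integral>\<^sup>+ \<omega>. \<integral>\<^sup>+ y. ennreal (p y) * (smoothed e y * near e (X k \<omega>) (X l \<omega>)) \<partial>lborel \<partial>M)"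
    using assms
    by (intro nn_integral_isolated[where S = "{k, l}" and G = "\<lambda>z y. smoothed e y * near e (z k) (z l)"]) auto
  also have "\<dots> = (\<integral>\<^sup>+ \<omega>. pair_mass e (\<lambda>x. ennreal (p x)) * near e (X k \<omega>) (X l \<omega>) \<partial>M)"
    by (simp add: pair_mass_eq_smoothed mult.assoc[symmetric] nn_integral_multc)
  also have "\<dots> = (pair_mass e (\<lambda>x. ennreal (p x)))\<^sup>2"
    using assms by (simp add: nn_integral_cmult nn_integral_near_far power2_eq_square)
  finally show ?thesis .
qed

text \<open>
  Here \<open>i\<close> and \<open>k\<close> may be close together or equal, while \<open>j\<close> and \<open>l\<close> are isolated. Integrating out
  \<open>X j\<close> and \<open>X l\<close> leaves the product of the smoothed density at \<open>X i\<close> and at \<open>X k\<close>. Whatever the joint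
  law of these two vectors is, the product is at most the sum of the squares, which involves the
  marginal law alone.
\<close>

lemma nn_integral_near_near_shared:
  assumes ge: "i \<ge> 1" "j \<ge> 1" "k \<ge> 1" "l \<ge> 1"
    and far: "far i j" "far k j" "far l j" "far i l" "far k l"
  shows "(\<integral>\<^sup>+ \<omega>. near e (X i \<omega>) (X j \<omega>) * near e (X k \<omega>) (X l \<omega>) \<partial>M)
    \<le> 2 * (\<integral>\<^sup>+ x. ennreal (p x) * (smoothed e x)\<^sup>2 \<partial>lborel)"
proof -
  have "(\<integral>\<^sup>+ \<omega>. near e (X i \<omega>) (X j \<omega>) * near e (X k \<omega>) (X l \<omega>) \<partial>M) =
     (\<integral>\<^sup>+ \<omega>. smoothed e (X i \<omega>) * near e (X k \<omega>) (X l \<omega>) \<partial>M)"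
    using assms by (intro nn_integral_near_near)
  also have "\<dots> = (\<integral>\<^sup>+ \<omega>. \<integral>\<^sup>+ y. ennreal (p y) * (smoothed e (X i \<omega>) * near e (X k \<omega>) y) \<partial>lborel \<partial>M)"
    using assms
    by (intro nn_integral_isolated[where S = "{i, k}" and G = "\<lambda>z y. smoothed e (z i) * near e (z k) y"]) auto
  also have "\<dots> = (\<integral>\<^sup>+ \<omega>. smoothed e (X i \<omega>) * smoothed e (X k \<omega>) \<partial>M)"
    by (simp add: mult.left_commute[of "ennreal _" "smoothed _ _"] nn_integral_cmult smoothed_def[of e "X k _"])
  also have "\<dots> \<le> (\<integral>\<^sup>+ \<omega>. (smoothed e (X i \<omega>))\<^sup>2 + (smoothed e (X k \<omega>))\<^sup>2 \<partial>M)"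
  proof (rule nn_integral_mono)
    have "a * b \<le> a\<^sup>2 + b\<^sup>2" for a b :: ennreal
    proof (cases "a \<le> b")
      case True
      then have "a * b \<le> 0 + b * b" by (simp add: mult_right_mono)
      also have "\<dots> \<le> a * a + b * b" by (intro add_right_mono) simp
      finally show ?thesis by (simp add: power2_eq_square)
    next
      case False
      then have "a * b \<le> a * a + 0" by (simp add: mult_left_mono)
      also have "\<dots> \<le> a * a + b * b" by (intro add_left_mono) simp
      finally show ?thesis by (simp add: power2_eq_square)
    qed
    then show "smoothed e (X i \<omega>) * smoothed e (X k \<omega>) \<le> (smoothed e (X i \<omega>))\<^sup>2 + (smoothed e (X k \<omega>))\<^sup>2" for \<omega> .
  qed
  also have "\<dots> = (\<integral>\<^sup>+ x. ennreal (p x) * (smoothed e x)\<^sup>2 \<partial>lborel) + (\<integral>\<^sup>+ x. ennreal (p x) * (smoothed e x)\<^sup>2 \<partial>lborel)"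
    using ge nn_integral_X[of _ "\<lambda>x. (smoothed e x)\<^sup>2"] by (simp add: nn_integral_add)
  finally show ?thesis by (simp add: mult_2)
qed

end

section \<open>Covariances of far pairs\<close>

lemma (in prob_space) expectation_square_centred_count:
  assumes "finite F" and A [measurable]: "\<And>a. a \<in> F \<Longrightarrow> A a \<in> events" and J: "\<And>a. a \<in> F \<Longrightarrow> prob (A a) = J"
  shows "integrable M (\<lambda>\<omega>. ((\<Sum>a\<in>F. indicator (A a) \<omega>) - real (card F) * J)\<^sup>2)"
    and "expectation (\<lambda>\<omega>. ((\<Sum>a\<in>F. indicator (A a) \<omega>) - real (card F) * J)\<^sup>2) =
      (\<Sum>a\<in>F. \<Sum>b\<in>F. prob (A a \<inter> A b) - J\<^sup>2)"
proof -
  let ?h = "\<lambda>a b \<omega>. (indicator (A a \<inter> A b) \<omega> - J * indicator (A a) \<omega> - J * indicator (A b) \<omega> + J\<^sup>2 :: real)"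
  have eq: "((\<Sum>a\<in>F. indicator (A a) \<omega>) - real (card F) * J)\<^sup>2 = (\<Sum>a\<in>F. \<Sum>b\<in>F. ?h a b \<omega>)" for \<omega>
  proof -
    have "(\<Sum>a\<in>F. indicator (A a) \<omega>) - real (card F) * J = (\<Sum>a\<in>F. indicator (A a) \<omega> - J)"
      by (simp add: sum_subtractf)
    then have "((\<Sum>a\<in>F. indicator (A a) \<omega>) - real (card F) * J)\<^sup>2
        = (\<Sum>a\<in>F. \<Sum>b\<in>F. (indicator (A a) \<omega> - J) * (indicator (A b) \<omega> - J))"
      by (simp add: power2_eq_square sum_product)
    also have "\<dots> = (\<Sum>a\<in>F. \<Sum>b\<in>F. ?h a b \<omega>)"
      by (intro sum.cong refl) (simp add: indicator_inter_arith algebra_simps power2_eq_square)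
    finally show ?thesis .
  qed
  have int: "integrable M (?h a b)" if "a \<in> F" "b \<in> F" for a b
  proof -
    have 1: "integrable M (indicator E :: 'a \<Rightarrow> real)" if "E \<in> events" for E
      using that by (intro integrable_real_indicator) (auto simp: emeasure_eq_measure)
    show ?thesis
      using that A by (intro Bochner_Integration.integrable_add Bochner_Integration.integrable_diff
        integrable_mult_right 1 integrable_const sets.Int) auto
  qed
  show "integrable M (\<lambda>\<omega>. ((\<Sum>a\<in>F. indicator (A a) \<omega>) - real (card F) * J)\<^sup>2)"
    unfolding eq using int by auto
  have "expectation (?h a b) = prob (A a \<inter> A b) - J\<^sup>2" if "a \<in> F" "b \<in> F" for a b
  proof -
    have [measurable]: "A a \<in> events" "A b \<in> events" using that A by auto
    have "expectation (?h a b) = prob (A a \<inter> A b) - J * prob (A a) - J * prob (A b) + J\<^sup>2"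
      by (simp add: emeasure_eq_measure prob_space)
    then show ?thesis using J that by (simp add: power2_eq_square)
  qed
  then show "expectation (\<lambda>\<omega>. ((\<Sum>a\<in>F. indicator (A a) \<omega>) - real (card F) * J)\<^sup>2) =
      (\<Sum>a\<in>F. \<Sum>b\<in>F. prob (A a \<inter> A b) - J\<^sup>2)"
    unfolding eq using int by (simp add: Bochner_Integration.integral_sum)
qed

lemma (in m_dependent_sample) emeasure_close_event:
  assumes "i \<ge> 1" "j \<ge> 1"
  shows "emeasure M (close_event e i j) = (\<integral>\<^sup>+ \<omega>. near e (X i \<omega>) (X j \<omega>) \<partial>M)"
proof -
  have "emeasure M (close_event e i j) = (\<integral>\<^sup>+ \<omega>. indicator (close_event e i j) \<omega> \<partial>M)"
    using assms by (simp add: close_event_measurable)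
  also have "\<dots> = (\<integral>\<^sup>+ \<omega>. near e (X i \<omega>) (X j \<omega>) \<partial>M)"
    by (intro nn_integral_cong) (auto simp: close_event_def near_def indicator_def)
  finally show ?thesis .
qed

lemma (in m_dependent_sample) emeasure_close_event_Int:
  assumes "i \<ge> 1" "j \<ge> 1" "k \<ge> 1" "l \<ge> 1"
  shows "emeasure M (close_event e i j \<inter> close_event e k l) =
    (\<integral>\<^sup>+ \<omega>. near e (X i \<omega>) (X j \<omega>) * near e (X k \<omega>) (X l \<omega>) \<partial>M)"
proof -
  have "emeasure M (close_event e i j \<inter> close_event e k l) = (\<integral>\<^sup>+ \<omega>. indicator (close_event e i j \<inter> close_event e k l) \<omega> \<partial>M)"
    using assms by (simp add: close_event_measurable sets.Int)
  also have "\<dots> = (\<integral>\<^sup>+ \<omega>. near e (X i \<omega>) (X j \<omega>) * near e (X k \<omega>) (X l \<omega>) \<partial>M)"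
    by (intro nn_integral_cong) (auto simp: close_event_def near_def indicator_def)
  finally show ?thesis .
qed

context m_dependent_sample
begin

definition hit_prob :: "real \<Rightarrow> real" where
  "hit_prob e = enn2real (pair_mass e (\<lambda>x. ennreal (p x)))"

definition cube_mass :: real where
  "cube_mass = (LINT x|lborel. p x ^ 3)"

lemma nn_integral_square: "(\<integral>\<^sup>+ x. ennreal ((p x)\<^sup>2) \<partial>lborel) = ennreal (q2 p)"
  unfolding q2_def using p_L2 by (intro nn_integral_eq_integral) (auto simp: in_L_def)

lemma q2_nonneg: "q2 p \<ge> 0" by (simp add: q2_def)

lemma ennreal_hit_prob:
  assumes "e \<ge> 0"
  shows "ennreal (hit_prob e) = pair_mass e (\<lambda>x. ennreal (p x))"
proof -
  have "pair_mass e (\<lambda>x. ennreal (p x)) \<le> ennreal (ball_vol DIM('v) e) * ennreal (q2 p)"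
    using pair_mass_le[of p e] assms p_nonneg by (simp add: nn_integral_square)
  also have "\<dots> < \<top>" by (simp add: ennreal_mult_less_top)
  finally show ?thesis unfolding hit_prob_def by simp
qed

lemma hit_prob_nonneg: "hit_prob e \<ge> 0" by (simp add: hit_prob_def)

lemma hit_prob_le:
  assumes "e > 0"
  shows "hit_prob e \<le> ball_vol DIM('v) e * q2 p"
proof -
  have "ennreal (hit_prob e) \<le> ennreal (ball_vol DIM('v) e * q2 p)"
    using pair_mass_le[of p e] assms p_nonneg ball_vol_pos[of "DIM('v)" e]
    by (simp add: nn_integral_square ennreal_hit_prob ennreal_mult q2_nonneg)
  then show ?thesis
    using ball_vol_pos[of "DIM('v)" e] assms q2_nonneg by (simp add: ennreal_le_iff)
qed

text \<open>
  The upper bound holds for every radius, so only the limit inferior requires a limit argument.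
\<close>

lemma hit_prob_asymp:
  assumes e: "\<forall>\<^sub>F n in sequentially. e n > 0" "e \<longlonglongrightarrow> 0"
  shows "(\<lambda>n. hit_prob (e n) / ball_vol DIM('v) (e n)) \<longlonglongrightarrow> q2 p"
proof -
  let ?u = "\<lambda>n. pair_mass (e n) (\<lambda>x. ennreal (p x)) / ennreal (ball_vol DIM('v) (e n))"
  have u: "\<forall>\<^sub>F n in sequentially. ?u n = ennreal (hit_prob (e n) / ball_vol DIM('v) (e n))"
    using e(1)
  proof eventually_elim
    case (elim n)
    then show ?case
      using ball_vol_pos[of "DIM('v)" "e n"] by (simp add: ennreal_hit_prob[symmetric] divide_ennreal hit_prob_nonneg)
  qed
  have ub: "\<forall>\<^sub>F n in sequentially. ?u n \<le> ennreal (q2 p)"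
    using u e(1)
  proof eventually_elim
    case (elim n)
    then show ?case
      using ball_vol_pos[of "DIM('v)" "e n"] hit_prob_le[of "e n"] q2_nonneg
      by (auto simp: divide_le_eq mult.commute intro!: ennreal_leI)
  qed
  have "ennreal (q2 p) = (\<integral>\<^sup>+ x. ennreal (p x) * ennreal (p x) \<partial>lborel)"
    unfolding nn_integral_square[symmetric] by (simp add: power2_eq_square ennreal_mult p_nonneg)
  also have "\<dots> \<le> liminf ?u"
    by (rule liminf_pair_mass[OF _ e]) simp
  finally have lb: "ennreal (q2 p) \<le> liminf ?u" .
  have "limsup ?u \<le> ennreal (q2 p)" using ub by (rule Limsup_bounded)
  moreover have "liminf ?u \<le> limsup ?u" by (rule Liminf_le_Limsup) simp
  ultimately have "?u \<longlonglongrightarrow> ennreal (q2 p)"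
    using lb by (subst tendsto_iff_Liminf_eq_Limsup) auto
  then have "(\<lambda>n. ennreal (hit_prob (e n) / ball_vol DIM('v) (e n))) \<longlonglongrightarrow> ennreal (q2 p)"
    using tendsto_cong[OF u] by blast
  then show ?thesis
  proof (rule tendsto_ennrealD)
    show "q2 p \<ge> 0" by (rule q2_nonneg)
    show "\<forall>\<^sub>F n in sequentially. 0 \<le> hit_prob (e n) / ball_vol DIM('v) (e n)"
      using e(1) by eventually_elim (use ball_vol_pos[of "DIM('v)"] hit_prob_nonneg in \<open>simp add: less_imp_le\<close>)
  qed
qed

lemma prob_close_event_far:
  assumes "i \<ge> 1" "j \<ge> 1" "far i j" "e \<ge> 0"
  shows "prob (close_event e i j) = hit_prob e"
proof -
  have "ennreal (prob (close_event e i j)) = ennreal (hit_prob e)"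
    using assms by (simp add: emeasure_eq_measure[symmetric] emeasure_close_event nn_integral_near_far ennreal_hit_prob)
  then show ?thesis using hit_prob_nonneg by simp
qed

lemma prob_Int_all_far:
  assumes ge: "i \<ge> 1" "j \<ge> 1" "k \<ge> 1" "l \<ge> 1" and "e \<ge> 0"
    and far: "far i j" "far k l" "far i k" "far i l" "far j k" "far j l"
  shows "prob (close_event e i j \<inter> close_event e k l) = (hit_prob e)\<^sup>2"
proof -
  have "ennreal (prob (close_event e i j \<inter> close_event e k l)) = ennreal ((hit_prob e)\<^sup>2)"
    using nn_integral_near_near_all_far[OF ge, of e] far ge \<open>e \<ge> 0\<close>
    by (simp add: emeasure_eq_measure[symmetric] emeasure_close_event_Int far_commute ennreal_hit_prob[symmetric]
      ennreal_power hit_prob_nonneg)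
  then show ?thesis by simp
qed

lemma close_event_commute: "close_event e i j = close_event e j i"
  by (simp add: close_event_def norm_minus_commute)

lemma prob_Int_shared:
  assumes ge: "i \<ge> 1" "j \<ge> 1" "k \<ge> 1" "l \<ge> 1" and e: "e > 0" and L3: "in_L 3 p"
    and far: "far i j" "far k l" "far i l" "far j k" "far j l"
  shows "prob (close_event e i j \<inter> close_event e k l) \<le> 2 * cube_mass * (ball_vol DIM('v) e)\<^sup>2"
proof -
  have c: "(\<integral>\<^sup>+ x. ennreal (p x ^ 3) \<partial>lborel) = ennreal cube_mass"
    unfolding cube_mass_def using L3 p_nonneg by (intro nn_integral_eq_integral) (auto simp: in_L_def)
  have c0: "cube_mass \<ge> 0" by (simp add: cube_mass_def p_nonneg)
  have b: "ball_vol DIM('v) e > 0" using ball_vol_pos[of "DIM('v)" e] e by simp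
  have "ennreal (prob (close_event e i j \<inter> close_event e k l))
      \<le> 2 * (\<integral>\<^sup>+ x. ennreal (p x) * (smoothed e x)\<^sup>2 \<partial>lborel)"
    using nn_integral_near_near_shared[OF ge, of e] far ge
    by (simp add: emeasure_eq_measure[symmetric] emeasure_close_event_Int far_commute)
  also have "\<dots> \<le> 2 * ((ennreal (ball_vol DIM('v) e))\<^sup>2 * ennreal cube_mass)"
    unfolding smoothed_def c[symmetric] using e p_nonneg by (intro mult_left_mono triple_mass_le) auto
  also have "\<dots> = ennreal (2 * cube_mass * (ball_vol DIM('v) e)\<^sup>2)"
    using b c0 by (simp add: ennreal_power ennreal_mult mult.commute mult.left_commute mult.assoc)
  finally show ?thesis using c0 by (simp add: ennreal_le_iff)
qed

definition nearby :: "nat \<Rightarrow> nat \<Rightarrow> real" where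
  "nearby i j = of_bool (\<not> far i j)"

text \<open>
  The six products of two \<open>nearby\<close> factors sum to at least \<open>1\<close> precisely when at least two of
  the four cross pairs are nearby. Written as a sum of products, the bound can be summed over all quadruples of
  indices without a case distinction. With exactly one nearby cross pair, exchanging the indices
  within the two pairs moves the coincidence to the first positions.
\<close>

lemma covariance_bound:
  assumes ge: "i \<ge> 1" "j \<ge> 1" "k \<ge> 1" "l \<ge> 1" and e: "e > 0" and L3: "in_L 3 p"
    and far: "far i j" "far k l"
  shows "prob (close_event e i j \<inter> close_event e k l) - (hit_prob e)\<^sup>2 \<le>
    2 * cube_mass * (ball_vol DIM('v) e)\<^sup>2 * (nearby i k + nearby i l + nearby j k + nearby j l)
    + hit_prob e * (nearby i k * nearby i l + nearby i k * nearby j k + nearby i k * nearby j l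
        + nearby i l * nearby j k + nearby i l * nearby j l + nearby j k * nearby j l)"
    (is "?P - _ \<le> ?B * ?s + ?J * ?d")
proof -
  have B: "?B \<ge> 0" by (simp add: cube_mass_def p_nonneg)
  have nn: "nearby i j \<ge> 0" for i j by (simp add: nearby_def)
  consider (none) "far i k" "far i l" "far j k" "far j l"
    | (ik) "\<not> far i k" "far i l" "far j k" "far j l"
    | (il) "far i k" "\<not> far i l" "far j k" "far j l"
    | (jk) "far i k" "far i l" "\<not> far j k" "far j l"
    | (jl) "far i k" "far i l" "far j k" "\<not> far j l"
    | (two) "?d \<ge> 1"
    unfolding nearby_def by (cases "far i k"; cases "far i l"; cases "far j k"; cases "far j l") auto
  then show ?thesis
  proof cases
    case none
    then have "?P = (hit_prob e)\<^sup>2" using ge e far by (intro prob_Int_all_far) auto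
    then show ?thesis using B nn hit_prob_nonneg[of e] by simp
  next
    case ik
    then have "?P \<le> ?B" using ge e far L3 by (intro prob_Int_shared) auto
    then show ?thesis using ik by (simp add: nearby_def add_increasing2 diff_le_eq)
  next
    case il
    then have "prob (close_event e i j \<inter> close_event e l k) \<le> ?B" using ge e far L3 by (intro prob_Int_shared) (auto simp: far_commute)
    then have "?P \<le> ?B" by (simp add: close_event_commute)
    then show ?thesis using il by (simp add: nearby_def add_increasing2 diff_le_eq)
  next
    case jk
    then have "prob (close_event e j i \<inter> close_event e k l) \<le> ?B" using ge e far L3 by (intro prob_Int_shared) (auto simp: far_commute)
    then have "?P \<le> ?B" by (simp add: close_event_commute)
    then show ?thesis using jk by (simp add: nearby_def add_increasing2 diff_le_eq)
  next
    case jl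
    then have "prob (close_event e j i \<inter> close_event e l k) \<le> ?B" using ge e far L3 by (intro prob_Int_shared) (auto simp: far_commute)
    then have "?P \<le> ?B" by (simp add: close_event_commute)
    then show ?thesis using jl by (simp add: nearby_def add_increasing2 diff_le_eq)
  next
    case two
    have "?P \<le> prob (close_event e i j)"
      using ge by (intro finite_measure_mono close_event_measurable) auto
    also have "\<dots> = ?J * 1" using ge e far by (simp add: prob_close_event_far)
    also have "\<dots> \<le> ?J * ?d" using two hit_prob_nonneg by (rule mult_left_mono)
    finally have "?P \<le> ?J * ?d" .
    moreover have "0 \<le> ?B * ?s" using B nn by simp
    ultimately show ?thesis by (intro order_trans[OF _ add_mono[of 0 "?B * ?s" ?P "?J * ?d"]]) auto
  qed
qed

end

section \<open>Second moment of the number of close far pairs\<close>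

context m_dependent_sample
begin

text \<open>
  At most \<open>m\<close> indices on either side of \<open>i\<close>, and \<open>i\<close> itself.
\<close>

lemma sum_nearby_le: "(\<Sum>k\<in>{1..n}. nearby i k) \<le> real (2 * m + 1)"
proof -
  have "(\<Sum>k\<in>{1..n}. nearby i k) = real (card {k\<in>{1..n}. \<not> far i k})"
    by (simp add: nearby_def sum.If_cases of_bool_def Int_def)
  also have "\<dots> \<le> real (card {i - m..i + m})"
    by (intro of_nat_mono card_mono) (auto simp: far_def)
  also have "\<dots> \<le> real (2 * m + 1)" by simp
  finally show ?thesis .
qed

lemma nearby_commute: "nearby i j = nearby j i"
  by (simp add: nearby_def far_commute)

lemma nearby_nonneg: "0 \<le> nearby i j"
  by (simp add: nearby_def)

text \<open>
  Each term ties one index to another and leaves three of the four indices free.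
\<close>

lemma sum_overlap_le:
  fixes n :: nat
  defines "I \<equiv> {1..n}" and "c \<equiv> real (2 * m + 1)"
  shows "(\<Sum>i\<in>I. \<Sum>j\<in>I. \<Sum>k\<in>I. \<Sum>l\<in>I. nearby i k + nearby i l + nearby j k + nearby j l) \<le> 4 * c * real n ^ 3"
proof -
  have bd: "(\<Sum>x\<in>I. f x) \<le> real n * K" if "\<And>x. x \<in> I \<Longrightarrow> f x \<le> K" for f :: "nat \<Rightarrow> real" and K
    using sum_bounded_above[of I f K] that by (simp add: I_def)
  have c: "(\<Sum>k\<in>I. nearby i k) \<le> c" for i
    unfolding I_def c_def by (rule sum_nearby_le)
  have "(\<Sum>k\<in>I. \<Sum>l\<in>I. nearby i k + nearby i l + nearby j k + nearby j l) \<le> 4 * (real n * c)" for i j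
  proof -
    have "(\<Sum>k\<in>I. \<Sum>l\<in>I. nearby i k + nearby i l + nearby j k + nearby j l)
        = real n * (\<Sum>k\<in>I. nearby i k) + real n * (\<Sum>l\<in>I. nearby i l)
          + real n * (\<Sum>k\<in>I. nearby j k) + real n * (\<Sum>l\<in>I. nearby j l)"
      by (simp add: sum.distrib sum_distrib_left I_def)
    also have "\<dots> \<le> real n * c + real n * c + real n * c + real n * c"
      by (intro add_mono mult_left_mono c) auto
    finally show ?thesis by (simp add: mult.commute)
  qed
  then have "(\<Sum>i\<in>I. \<Sum>j\<in>I. \<Sum>k\<in>I. \<Sum>l\<in>I. nearby i k + nearby i l + nearby j k + nearby j l)
      \<le> real n * (real n * (4 * (real n * c)))"
    by (intro bd)
  then show ?thesis by (simp add: power3_eq_cube algebra_simps)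
qed

text \<open>
  Each term leaves two of the four indices free. Except for the products with a shared \<open>k\<close> or a shared
  \<open>l\<close>, the sum over \<open>k\<close> and \<open>l\<close> alone is bounded; those two exceptions form a chain from \<open>i\<close> to \<open>j\<close>,
  for which the sum over \<open>j\<close> is needed as well.
\<close>

lemma sum_double_overlap_le:
  fixes n :: nat
  defines "I \<equiv> {1..n}" and "c \<equiv> real (2 * m + 1)"
  shows "(\<Sum>i\<in>I. \<Sum>j\<in>I. \<Sum>k\<in>I. \<Sum>l\<in>I. nearby i k * nearby i l + nearby i k * nearby j k + nearby i k * nearby j l
        + nearby i l * nearby j k + nearby i l * nearby j l + nearby j k * nearby j l) \<le> 6 * c\<^sup>2 * (real n)\<^sup>2"
proof -
  have bd: "(\<Sum>x\<in>I. f x) \<le> real n * K" if "\<And>x. x \<in> I \<Longrightarrow> f x \<le> K" for f :: "nat \<Rightarrow> real" and K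
    using sum_bounded_above[of I f K] that by (simp add: I_def)
  have c: "(\<Sum>k\<in>I. nearby i k) \<le> c" for i
    unfolding I_def c_def by (rule sum_nearby_le)
  have c': "(\<Sum>k\<in>I. nearby k i) \<le> c" for i
    using c[of i] by (simp add: nearby_commute)
  have c0: "c \<ge> 0" by (simp add: c_def)
  have s0: "0 \<le> (\<Sum>k\<in>I. nearby i k)" for i by (intro sum_nonneg nearby_nonneg)
  have inner: "(\<Sum>k\<in>I. \<Sum>l\<in>I. nearby i k * nearby i l + nearby i k * nearby j l + nearby i l * nearby j k + nearby j k * nearby j l) \<le> 4 * c\<^sup>2" for i j
  proof -
    have "(\<Sum>k\<in>I. \<Sum>l\<in>I. nearby i k * nearby i l + nearby i k * nearby j l + nearby i l * nearby j k + nearby j k * nearby j l)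
        = (\<Sum>k\<in>I. nearby i k) * (\<Sum>l\<in>I. nearby i l) + (\<Sum>k\<in>I. nearby i k) * (\<Sum>l\<in>I. nearby j l)
          + (\<Sum>l\<in>I. nearby i l) * (\<Sum>k\<in>I. nearby j k) + (\<Sum>k\<in>I. nearby j k) * (\<Sum>l\<in>I. nearby j l)"
      by (simp add: sum.distrib sum_product sum.swap[of "\<lambda>k l. nearby i l * nearby j k"])
    also have "\<dots> \<le> c * c + c * c + c * c + c * c"
      by (intro add_mono mult_mono c s0 c0)
    finally show ?thesis by (simp add: power2_eq_square)
  qed
  \<comment> \<open>Two indices with a common neighbour: sum over \<open>j\<close> first, then over the neighbour \<open>k\<close>.\<close>
  have chain: "(\<Sum>j\<in>I. \<Sum>k\<in>I. nearby i k * nearby j k) \<le> c\<^sup>2" for i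
  proof -
    have "(\<Sum>j\<in>I. \<Sum>k\<in>I. nearby i k * nearby j k) = (\<Sum>k\<in>I. nearby i k * (\<Sum>j\<in>I. nearby j k))"
      by (subst sum.swap) (simp add: sum_distrib_left)
    also have "\<dots> \<le> (\<Sum>k\<in>I. nearby i k * c)"
      by (intro sum_mono mult_left_mono c' nearby_nonneg)
    also have "\<dots> = (\<Sum>k\<in>I. nearby i k) * c" by (simp add: sum_distrib_right)
    also have "\<dots> \<le> c * c" by (intro mult_right_mono c c0)
    finally show ?thesis by (simp add: power2_eq_square)
  qed
  have "(\<Sum>i\<in>I. \<Sum>j\<in>I. \<Sum>k\<in>I. \<Sum>l\<in>I. nearby i k * nearby i l + nearby i k * nearby j k + nearby i k * nearby j l
        + nearby i l * nearby j k + nearby i l * nearby j l + nearby j k * nearby j l)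
      = (\<Sum>i\<in>I. \<Sum>j\<in>I. \<Sum>k\<in>I. \<Sum>l\<in>I. nearby i k * nearby i l + nearby i k * nearby j l + nearby i l * nearby j k + nearby j k * nearby j l)
        + 2 * real n * (\<Sum>i\<in>I. \<Sum>j\<in>I. \<Sum>k\<in>I. nearby i k * nearby j k)"
    by (simp add: sum.distrib I_def sum_distrib_left mult.assoc)
  also have "\<dots> \<le> real n * (real n * (4 * c\<^sup>2)) + 2 * real n * (real n * c\<^sup>2)"
    by (intro add_mono mult_left_mono bd inner chain) auto
  finally show ?thesis by (simp add: power2_eq_square algebra_simps)
qed

definition far_pairs :: "nat \<Rightarrow> (nat \<times> nat) set" where
  "far_pairs n = {(i, j). i \<in> {1..n} \<and> j \<in> {1..n} \<and> i + m < j}"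

definition near_pairs :: "nat \<Rightarrow> (nat \<times> nat) set" where
  "near_pairs n = {(i, j). i \<in> {1..n} \<and> j \<in> {1..n} \<and> i < j \<and> j \<le> i + m}"

definition hits :: "(nat \<times> nat) set \<Rightarrow> real \<Rightarrow> 'a \<Rightarrow> real" where
  "hits P e \<omega> = (\<Sum>(i, j)\<in>P. indicator (close_event e i j) \<omega>)"

lemma finite_far_pairs: "finite (far_pairs n)"
  by (rule finite_subset[of _ "{1..n} \<times> {1..n}"]) (auto simp: far_pairs_def)

lemma finite_near_pairs: "finite (near_pairs n)"
  by (rule finite_subset[of _ "{1..n} \<times> {1..n}"]) (auto simp: near_pairs_def)

lemma hits_measurable:
  assumes "P \<subseteq> {1..} \<times> {1..}"
  shows "hits P e \<in> borel_measurable M"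
  unfolding hits_def using assms
  by (intro borel_measurable_sum) (auto intro!: borel_measurable_indicator close_event_measurable)

text \<open>
  The covariance bound is nonnegative, so the sum over far pairs may be extended to all quadruples
  of indices, where the overlap counts apply.
\<close>

lemma far_hits_second_moment:
  assumes e: "e > 0" and L3: "in_L 3 p"
  defines "c \<equiv> real (2 * m + 1)"
  shows "integrable M (\<lambda>\<omega>. (hits (far_pairs n) e \<omega> - real (card (far_pairs n)) * hit_prob e)\<^sup>2)" (is ?int)
    and "expectation (\<lambda>\<omega>. (hits (far_pairs n) e \<omega> - real (card (far_pairs n)) * hit_prob e)\<^sup>2)
      \<le> 2 * cube_mass * (ball_vol DIM('v) e)\<^sup>2 * (4 * c * real n ^ 3) + hit_prob e * (6 * c\<^sup>2 * (real n)\<^sup>2)" (is ?le)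
proof -
  let ?F = "far_pairs n"
  let ?A = "\<lambda>(i, j). close_event e i j"
  let ?B = "2 * cube_mass * (ball_vol DIM('v) e)\<^sup>2"
  have F: "i \<ge> 1" "j \<ge> 1" "far i j" if "(i, j) \<in> ?F" for i j
    using that by (auto simp: far_pairs_def far_def)
  have hits: "hits ?F e = (\<lambda>\<omega>. \<Sum>a\<in>?F. indicator (?A a) \<omega>)"
    by (simp add: hits_def fun_eq_iff case_prod_unfold)
  have A: "?A a \<in> events" "prob (?A a) = hit_prob e" if "a \<in> ?F" for a
    using that F e by (cases a; auto simp: close_event_measurable prob_close_event_far)+
  note moment = expectation_square_centred_count[of ?F ?A "hit_prob e", OF finite_far_pairs A]
  show ?int unfolding hits by (rule moment(1))
  define s where "s = (\<lambda>i j k l. nearby i k + nearby i l + nearby j k + nearby j l)"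
  define d where "d = (\<lambda>i j k l. nearby i k * nearby i l + nearby i k * nearby j k + nearby i k * nearby j l
        + nearby i l * nearby j k + nearby i l * nearby j l + nearby j k * nearby j l)"
  define g where "g = (\<lambda>(i, j) (k, l). ?B * s i j k l + hit_prob e * d i j k l)"
  have "cube_mass \<ge> 0" by (simp add: cube_mass_def p_nonneg)
  then have g0: "0 \<le> g a b" for a b
    by (auto simp: g_def s_def d_def nearby_nonneg hit_prob_nonneg split: prod.split intro!: add_nonneg_nonneg mult_nonneg_nonneg)
  have iterated: "(\<Sum>a\<in>{1..n} \<times> {1..n}. f a) = (\<Sum>i\<in>{1..n}. \<Sum>j\<in>{1..n}. f (i, j))" for f :: "nat \<times> nat \<Rightarrow> real"
    by (simp add: sum.cartesian_product)
  have sub: "?F \<subseteq> {1..n} \<times> {1..n}" by (auto simp: far_pairs_def)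
  have "expectation (\<lambda>\<omega>. (hits ?F e \<omega> - real (card ?F) * hit_prob e)\<^sup>2)
      = (\<Sum>a\<in>?F. \<Sum>b\<in>?F. prob (?A a \<inter> ?A b) - (hit_prob e)\<^sup>2)"
    unfolding hits by (rule moment(2))
  also have "\<dots> \<le> (\<Sum>a\<in>?F. \<Sum>b\<in>?F. g a b)"
  proof (intro sum_mono)
    fix a b assume "a \<in> ?F" "b \<in> ?F"
    then show "prob (?A a \<inter> ?A b) - (hit_prob e)\<^sup>2 \<le> g a b"
      unfolding g_def s_def d_def using F e L3 by (cases a; cases b) (auto intro!: covariance_bound)
  qed
  also have "\<dots> \<le> (\<Sum>a\<in>{1..n} \<times> {1..n}. \<Sum>b\<in>?F. g a b)"
    using sub by (intro sum_mono2 sum_nonneg g0) auto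
  also have "\<dots> \<le> (\<Sum>a\<in>{1..n} \<times> {1..n}. \<Sum>b\<in>{1..n} \<times> {1..n}. g a b)"
    using sub by (intro sum_mono sum_mono2 g0) auto
  also have "\<dots> = (\<Sum>i\<in>{1..n}. \<Sum>j\<in>{1..n}. \<Sum>k\<in>{1..n}. \<Sum>l\<in>{1..n}. ?B * s i j k l + hit_prob e * d i j k l)"
    by (simp only: iterated g_def prod.case)
  also have "\<dots> = ?B * (\<Sum>i\<in>{1..n}. \<Sum>j\<in>{1..n}. \<Sum>k\<in>{1..n}. \<Sum>l\<in>{1..n}. s i j k l)
      + hit_prob e * (\<Sum>i\<in>{1..n}. \<Sum>j\<in>{1..n}. \<Sum>k\<in>{1..n}. \<Sum>l\<in>{1..n}. d i j k l)"
    by (simp add: sum.distrib sum_distrib_left)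
  also have "\<dots> \<le> ?B * (4 * c * real n ^ 3) + hit_prob e * (6 * c\<^sup>2 * (real n)\<^sup>2)"
    unfolding s_def d_def c_def using \<open>cube_mass \<ge> 0\<close>
    by (intro add_mono mult_left_mono sum_overlap_le sum_double_overlap_le hit_prob_nonneg) auto
  finally show ?le .
qed

definition lag_prob :: "real \<Rightarrow> nat \<Rightarrow> real" where
  "lag_prob e k = prob (close_event e 1 (1 + k))"

text \<open>
  Stationarity: the event depends on the joint law of two vectors, which is invariant under the shift
  by \<open>i - 1\<close>.
\<close>

lemma prob_close_event_lag:
  assumes "i \<ge> 1"
  shows "prob (close_event e i (i + k)) = lag_prob e k"
proof -
  let ?J = "{1, 1 + k}"
  let ?E = "{z \<in> space (PiM ?J (\<lambda>_. borel :: 'v measure)). norm (z 1 - z (1 + k)) \<le> e}"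
  have E: "?E \<in> sets (PiM ?J (\<lambda>_. borel :: 'v measure))" by measurable
  have m: "(\<lambda>\<omega>. \<lambda>i\<in>?J. X (i + h) \<omega>) \<in> measurable M (PiM ?J (\<lambda>_. borel))" for h
    by (intro measurable_restrict X_measurable) auto
  have vim: "(\<lambda>\<omega>. \<lambda>i\<in>?J. X (i + h) \<omega>) -` ?E \<inter> space M = close_event e (1 + h) (1 + h + k)" for h
    by (auto simp: close_event_def space_PiM PiE_iff add_ac)
  have "measure (distr M (PiM ?J (\<lambda>_. borel)) (\<lambda>\<omega>. \<lambda>j\<in>?J. X (j + h) \<omega>)) ?E =
        measure (distr M (PiM ?J (\<lambda>_. borel)) (\<lambda>\<omega>. \<lambda>j\<in>?J. X (j + 0) \<omega>)) ?E" for h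
    using stationary by (simp add: strictly_stationary_def)
  from this[of "i - 1"] show ?thesis
    unfolding measure_distr[OF m E] vim lag_prob_def using assms by simp
qed

lemma expectation_near_hits:
  "integrable M (hits (near_pairs n) e)"
  "expectation (hits (near_pairs n) e) \<le> real n * (\<Sum>k\<in>{1..m}. lag_prob e k)"
proof -
  have N: "i \<ge> 1" "j \<ge> 1" if "(i, j) \<in> near_pairs n" for i j using that by (auto simp: near_pairs_def)
  have int: "integrable M (indicator (close_event e i j) :: 'a \<Rightarrow> real)" if "(i, j) \<in> near_pairs n" for i j
    using N[OF that] by (intro integrable_real_indicator) (auto simp: emeasure_eq_measure close_event_measurable)
  have h: "hits (near_pairs n) e = (\<lambda>\<omega>. \<Sum>a\<in>near_pairs n. indicator (close_event e (fst a) (snd a)) \<omega>)"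
    by (simp add: hits_def fun_eq_iff case_prod_unfold)
  show "integrable M (hits (near_pairs n) e)"
    unfolding h using int by (intro Bochner_Integration.integrable_sum) auto
  have "expectation (hits (near_pairs n) e) = (\<Sum>a\<in>near_pairs n. prob (close_event e (fst a) (snd a)))"
    unfolding h using int N
    by (subst Bochner_Integration.integral_sum) (auto simp: close_event_measurable intro!: sum.cong)
  \<comment> \<open>Parametrise near pairs by the first index and the lag; dropping \<open>i + k \<le> n\<close> only adds terms.\<close>
  also have "\<dots> \<le> (\<Sum>a\<in>(\<lambda>(i, k). (i, i + k)) ` ({1..n} \<times> {1..m}). prob (close_event e (fst a) (snd a)))"
  proof (rule sum_mono2)
    show "near_pairs n \<subseteq> (\<lambda>(i, k). (i, i + k)) ` ({1..n} \<times> {1..m})"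
    proof
      fix a assume "a \<in> near_pairs n"
      then obtain i j where "a = (i, j)" "i \<in> {1..n}" "i < j" "j \<le> i + m"
        by (auto simp: near_pairs_def)
      then show "a \<in> (\<lambda>(i, k). (i, i + k)) ` ({1..n} \<times> {1..m})"
        by (intro image_eqI[of _ _ "(i, j - i)"]) auto
    qed
  qed auto
  also have "\<dots> = (\<Sum>(i, k)\<in>{1..n} \<times> {1..m}. prob (close_event e i (i + k)))"
    by (subst sum.reindex) (auto simp: inj_on_def case_prod_unfold)
  also have "\<dots> = (\<Sum>(i, k)\<in>{1..n} \<times> {1..m}. lag_prob e k)"
    by (intro sum.cong) (auto simp: prob_close_event_lag)
  also have "\<dots> = real n * (\<Sum>k\<in>{1..m}. lag_prob e k)"
    by (simp add: sum.cartesian_product[symmetric])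
  finally show "expectation (hits (near_pairs n) e) \<le> real n * (\<Sum>k\<in>{1..m}. lag_prob e k)" .
qed

definition pair_count :: "real \<Rightarrow> nat \<Rightarrow> 'a \<Rightarrow> real" where
  "pair_count e n \<omega> = (\<Sum>j\<in>{1..n}. \<Sum>i\<in>{1..<j}. of_bool (norm (X i \<omega> - X j \<omega>) \<le> e))"

lemma sum_pairs_split:
  fixes f :: "nat \<Rightarrow> nat \<Rightarrow> real"
  shows "(\<Sum>j\<in>{1..n}. \<Sum>i\<in>{1..<j}. f i j) = (\<Sum>(i, j)\<in>far_pairs n. f i j) + (\<Sum>(i, j)\<in>near_pairs n. f i j)"
proof -
  have "(\<Sum>j\<in>{1..n}. \<Sum>i\<in>{1..<j}. f i j) = (\<Sum>(j, i)\<in>(SIGMA j:{1..n}. {1..<j}). f i j)"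
    by (rule sum.Sigma) auto
  also have "\<dots> = (\<Sum>(i, j)\<in>far_pairs n \<union> near_pairs n. f i j)"
    by (rule sum.reindex_bij_witness[of _ "\<lambda>(i, j). (j, i)" "\<lambda>(i, j). (j, i)"])
       (auto simp: far_pairs_def near_pairs_def)
  also have "\<dots> = (\<Sum>(i, j)\<in>far_pairs n. f i j) + (\<Sum>(i, j)\<in>near_pairs n. f i j)"
    by (rule sum.union_disjoint[OF finite_far_pairs finite_near_pairs]) (auto simp: far_pairs_def near_pairs_def)
  finally show ?thesis .
qed

lemma pair_count_split:
  assumes "\<omega> \<in> space M"
  shows "pair_count e n \<omega> = hits (far_pairs n) e \<omega> + hits (near_pairs n) e \<omega>"
proof -
  have "of_bool (norm (X i \<omega> - X j \<omega>) \<le> e) = (indicator (close_event e i j) \<omega> :: real)" for i j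
    using assms by (simp add: close_event_def indicator_def)
  then show ?thesis
    unfolding pair_count_def hits_def by (simp only: sum_pairs_split)
qed

lemma card_pairs: "card (far_pairs n) + card (near_pairs n) = n choose 2"
proof -
  have "real (card (far_pairs n) + card (near_pairs n)) = (\<Sum>j\<in>{1..n}. \<Sum>i\<in>{1..<j}. 1)"
    unfolding sum_pairs_split by simp
  also have "\<dots> = (\<Sum>j\<in>{1..n}. real (j - 1))" by simp
  also have "\<dots> = real (n choose 2)"
    by (induction n) (auto simp: numeral_2_eq_2)
  finally show ?thesis by simp
qed

lemma card_near_pairs_le: "card (near_pairs n) \<le> n * m"
proof -
  have "near_pairs n \<subseteq> (SIGMA i:{1..n}. {i + 1..i + m})"
    by (auto simp: near_pairs_def)
  then have "card (near_pairs n) \<le> card (SIGMA i:{1..n}. {i + 1..i + m})"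
    by (rule card_mono[rotated]) auto
  also have "\<dots> = n * m" by (simp add: card_SigmaI)
  finally show ?thesis .
qed

end

section \<open>Consistency for negligible short lags\<close>

text \<open>
  Markov's inequality for the \<open>k\<close>-th absolute moment. It is used with \<open>k = 2\<close> for the far pairs, whose
  fluctuations cancel, and with \<open>k = 1\<close> for the near pairs, whose count is small in mean.
\<close>

lemma (in prob_space) conv_in_prob_of_moment:
  assumes int: "\<forall>\<^sub>F n in sequentially. integrable M (\<lambda>\<omega>. \<bar>Y n \<omega>\<bar> ^ k)"
    and Y: "\<And>n. Y n \<in> borel_measurable M" and k: "k > 0"
    and le: "\<forall>\<^sub>F n in sequentially. expectation (\<lambda>\<omega>. \<bar>Y n \<omega>\<bar> ^ k) \<le> u n" and u: "u \<longlonglongrightarrow> 0"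
  shows "conv_in_prob M Y 0"
  unfolding conv_in_prob_def
proof (intro allI impI)
  fix \<delta> :: real assume \<delta>: "\<delta> > 0"
  show "(\<lambda>n. prob {\<omega> \<in> space M. \<bar>Y n \<omega> - 0\<bar> > \<delta>}) \<longlonglongrightarrow> 0"
  proof (rule tendsto_sandwich[where f = "\<lambda>_. 0"])
    show "(\<lambda>n. u n / \<delta> ^ k) \<longlonglongrightarrow> 0" using tendsto_divide[OF u tendsto_const[of "\<delta> ^ k"]] \<delta> by simp
    show "\<forall>\<^sub>F n in sequentially. prob {\<omega> \<in> space M. \<bar>Y n \<omega> - 0\<bar> > \<delta>} \<le> u n / \<delta> ^ k"
      using int le
    proof eventually_elim
      case (elim n)
      have [measurable]: "Y n \<in> borel_measurable M" by (rule Y)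
      have "prob {\<omega> \<in> space M. \<bar>Y n \<omega> - 0\<bar> > \<delta>} \<le> prob {\<omega> \<in> space M. \<bar>Y n \<omega>\<bar> ^ k \<ge> \<delta> ^ k}"
        using \<delta> by (intro finite_measure_mono) (auto intro!: power_mono)
      also have "\<dots> \<le> expectation (\<lambda>\<omega>. \<bar>Y n \<omega>\<bar> ^ k) / \<delta> ^ k"
        using \<delta> by (intro integral_Markov_inequality_measure[where A = "{}"] elim) auto
      also have "\<dots> \<le> u n / \<delta> ^ k" using elim \<delta> by (intro divide_right_mono) auto
      finally show ?case .
    qed
  qed auto
qed

lemma (in prob_space) conv_in_prob_perturb:
  assumes Y: "conv_in_prob M Y 0" "conv_in_prob M Z 0" and c: "c \<longlonglongrightarrow> q"
    and meas: "\<And>n. Y n \<in> borel_measurable M" "\<And>n. Z n \<in> borel_measurable M"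
    and W: "\<And>n \<omega>. \<omega> \<in> space M \<Longrightarrow> W n \<omega> = Y n \<omega> + Z n \<omega> + c n"
  shows "conv_in_prob M W q"
  unfolding conv_in_prob_def
proof (intro allI impI)
  fix \<delta> :: real assume \<delta>: "\<delta> > 0"
  let ?u = "\<lambda>n. prob {\<omega> \<in> space M. \<bar>Y n \<omega> - 0\<bar> > \<delta> / 3} + prob {\<omega> \<in> space M. \<bar>Z n \<omega> - 0\<bar> > \<delta> / 3}"
  show "(\<lambda>n. prob {\<omega> \<in> space M. \<bar>W n \<omega> - q\<bar> > \<delta>}) \<longlonglongrightarrow> 0"
  proof (rule tendsto_sandwich[where f = "\<lambda>_. 0"])
    have "\<delta> / 3 > 0" using \<delta> by simp
    then have "?u \<longlonglongrightarrow> 0 + 0"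
      using Y unfolding conv_in_prob_def by (intro tendsto_add) blast+
    then show "?u \<longlonglongrightarrow> 0" by simp
    have "\<forall>\<^sub>F n in sequentially. \<bar>c n - q\<bar> < \<delta> / 3"
      using tendstoD[OF c \<open>\<delta> / 3 > 0\<close>] by (simp add: dist_real_def)
    then show "\<forall>\<^sub>F n in sequentially. prob {\<omega> \<in> space M. \<bar>W n \<omega> - q\<bar> > \<delta>} \<le> ?u n"
    proof eventually_elim
      case (elim n)
      have [measurable]: "Y n \<in> borel_measurable M" "Z n \<in> borel_measurable M" by (rule meas)+
      have "{\<omega> \<in> space M. \<bar>W n \<omega> - q\<bar> > \<delta>} \<subseteq>
          {\<omega> \<in> space M. \<bar>Y n \<omega> - 0\<bar> > \<delta> / 3} \<union> {\<omega> \<in> space M. \<bar>Z n \<omega> - 0\<bar> > \<delta> / 3}"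
      proof
        fix \<omega> assume "\<omega> \<in> {\<omega> \<in> space M. \<bar>W n \<omega> - q\<bar> > \<delta>}"
        then have "\<omega> \<in> space M" "\<bar>Y n \<omega> + Z n \<omega> + c n - q\<bar> > \<delta>" by (auto simp: W)
        moreover from this(2) have "\<bar>Y n \<omega>\<bar> > \<delta> / 3 \<or> \<bar>Z n \<omega>\<bar> > \<delta> / 3"
          using elim by linarith
        ultimately show "\<omega> \<in> {\<omega> \<in> space M. \<bar>Y n \<omega> - 0\<bar> > \<delta> / 3} \<union> {\<omega> \<in> space M. \<bar>Z n \<omega> - 0\<bar> > \<delta> / 3}"
          by auto
      qed
      then have "prob {\<omega> \<in> space M. \<bar>W n \<omega> - q\<bar> > \<delta>} \<le>
          prob ({\<omega> \<in> space M. \<bar>Y n \<omega> - 0\<bar> > \<delta> / 3} \<union> {\<omega> \<in> space M. \<bar>Z n \<omega> - 0\<bar> > \<delta> / 3})"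
        by (rule finite_measure_mono) measurable
      also have "\<dots> \<le> ?u n" by (rule measure_Un_le) measurable
      finally show ?case .
    qed
  qed auto
qed

text \<open>
  Once \<open>1 / n\<close> is below \<open>q\<close>, the truncation can only move \<open>W n\<close> closer to \<open>q\<close>, and continuity of the
  logarithm at \<open>q\<close> applies.
\<close>

lemma (in prob_space) conv_in_prob_neg_ln:
  assumes W: "conv_in_prob M W q" and q: "q > 0" and meas: "\<And>n. W n \<in> borel_measurable M"
  shows "conv_in_prob M (\<lambda>n \<omega>. - ln (max (W n \<omega>) (1 / real n))) (- ln q)"
  unfolding conv_in_prob_def
proof (intro allI impI)
  fix \<delta> :: real assume \<delta>: "\<delta> > 0"
  have "isCont ln q" using q by (intro isCont_ln) simp
  then obtain \<eta> where \<eta>: "\<eta> > 0" "\<And>x. dist x q < \<eta> \<Longrightarrow> dist (ln x) (ln q) < \<delta>"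
    using \<delta> unfolding continuous_at_eps_delta by (metis dist_commute)
  show "(\<lambda>n. prob {\<omega> \<in> space M. \<bar>- ln (max (W n \<omega>) (1 / real n)) - - ln q\<bar> > \<delta>}) \<longlonglongrightarrow> 0"
  proof (rule tendsto_sandwich[where f = "\<lambda>_. 0"])
    show "(\<lambda>n. prob {\<omega> \<in> space M. \<bar>W n \<omega> - q\<bar> > \<eta> / 2}) \<longlonglongrightarrow> 0"
      using W[unfolded conv_in_prob_def, rule_format, of "\<eta> / 2"] \<eta>(1) by simp
    have "(\<lambda>n. 1 / real n) \<longlonglongrightarrow> 0" by (rule lim_1_over_n)
    then have "\<forall>\<^sub>F n in sequentially. 1 / real n < q" using q by (rule order_tendstoD)
    then show "\<forall>\<^sub>F n in sequentially. prob {\<omega> \<in> space M. \<bar>- ln (max (W n \<omega>) (1 / real n)) - - ln q\<bar> > \<delta>}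
        \<le> prob {\<omega> \<in> space M. \<bar>W n \<omega> - q\<bar> > \<eta> / 2}"
    proof eventually_elim
      case (elim n)
      have [measurable]: "W n \<in> borel_measurable M" by (rule meas)
      have "\<bar>W n \<omega> - q\<bar> > \<eta> / 2" if "\<bar>- ln (max (W n \<omega>) (1 / real n)) - - ln q\<bar> > \<delta>" for \<omega>
      proof (rule ccontr)
        assume "\<not> \<bar>W n \<omega> - q\<bar> > \<eta> / 2"
        then have "dist (max (W n \<omega>) (1 / real n)) q < \<eta>"
          using elim \<eta>(1) by (auto simp: dist_real_def max_def)
        from \<eta>(2)[OF this] that show False by (simp add: dist_real_def)
      qed
      then show ?case by (intro finite_measure_mono) auto
    qed
  qed auto
qed

context m_dependent_sample
begin

text \<open>
  Otherwise \<open>p\<close> would vanish almost everywhere and could not integrate to \<open>1\<close>.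
\<close>

lemma q2_pos: "q2 p > 0"
proof (rule ccontr)
  assume "\<not> q2 p > 0"
  then have "(\<integral>\<^sup>+ x. ennreal ((p x)\<^sup>2) \<partial>lborel) = 0" using q2_nonneg by (simp add: nn_integral_square)
  then have "AE x in lborel. p x = 0"
    by (subst (asm) nn_integral_0_iff_AE) auto
  then have "(\<integral>\<^sup>+ x. ennreal (p x) \<partial>lborel) = (\<integral>\<^sup>+ x. 0 \<partial>(lborel :: 'v measure))"
    by (intro nn_integral_cong_AE) auto
  moreover have "(\<integral>\<^sup>+ x. ennreal (p x) \<partial>lborel) = 1"
    using nn_integral_X[of 1 "\<lambda>_. 1"] by (simp add: emeasure_space_1)
  ultimately show False by simp
qed

text \<open>
  The estimator is the centred count \<open>Y\<close> of far pairs, plus the count \<open>Z\<close> of near pairs, plus the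
  normalised mean \<open>c\<close> of the far count. The last hypothesis is what makes \<open>Z\<close> negligible; it isolates
  the behaviour of the sequence at lags up to \<open>m\<close>.
\<close>

theorem pair_count_consistent:
  fixes e :: "nat \<Rightarrow> real"
  defines "b \<equiv> (\<lambda>n. ball_vol DIM('v) (e n))"
  assumes e: "\<forall>\<^sub>F n in sequentially. e n > 0" "e \<longlonglongrightarrow> 0" and L3: "in_L 3 p"
    and large: "filterlim (\<lambda>n. (real n)\<^sup>2 * b n) at_top sequentially"
    and lags: "(\<lambda>n. (\<Sum>k\<in>{1..m}. lag_prob (e n) k) / (real n * b n)) \<longlonglongrightarrow> 0"
  shows "conv_in_prob M (\<lambda>n \<omega>. pair_count (e n) n \<omega> / real (n choose 2) / b n) (q2 p)"
proof -
  let ?F = "far_pairs" and ?C = "near_pairs"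
  define D where "D = (\<lambda>n. real (n choose 2) * b n)"
  define h where "h = (\<lambda>n. hit_prob (e n))"
  define cc where "cc = real (2 * m + 1)"
  have ev: "\<forall>\<^sub>F n in sequentially. n \<ge> 2 \<and> e n > 0"
    using e(1) eventually_ge_at_top[of 2] by eventually_elim auto
  have b: "b n > 0" if "e n > 0" for n
    unfolding b_def using that by (intro ball_vol_pos) auto
  have choose: "real (n choose 2) \<ge> (real n)\<^sup>2 / 4" if "n \<ge> 2" for n
  proof -
    have "real (n choose 2) = real n * (real n - 1) / 2"
      by (induction n) (auto simp: numeral_2_eq_2 field_simps)
    moreover have "real n * 2 \<le> real n * real n" using that by (intro mult_left_mono) auto
    ultimately show ?thesis by (simp add: power2_eq_square field_simps)
  qed
  have D: "D n \<ge> (real n)\<^sup>2 / 4 * b n \<and> (real n)\<^sup>2 / 4 * b n > 0" if "n \<ge> 2" "e n > 0" for n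
    unfolding D_def using that b choose by (auto intro!: mult_right_mono simp: less_imp_le)
  define Y where "Y = (\<lambda>n \<omega>. (hits (?F n) (e n) \<omega> - real (card (?F n)) * h n) / D n)"
  define Z where "Z = (\<lambda>n \<omega>. hits (?C n) (e n) \<omega> / D n)"
  define c where "c = (\<lambda>n. real (card (?F n)) * h n / D n)"
  have hits_meas [measurable]: "hits (?F n) r \<in> borel_measurable M" "hits (?C n) r \<in> borel_measurable M" for n r
    by (intro hits_measurable; auto simp: far_pairs_def near_pairs_def)+
  have meas: "Y n \<in> borel_measurable M" "Z n \<in> borel_measurable M" for n
    unfolding Y_def Z_def by measurable
  have "conv_in_prob M Y 0"
  proof (rule conv_in_prob_of_moment[where k = 2, OF _ meas(1)])
    show "\<forall>\<^sub>F n in sequentially. integrable M (\<lambda>\<omega>. \<bar>Y n \<omega>\<bar>\<^sup>2)"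
      using ev
    proof eventually_elim
      case (elim n)
      then show ?case
        using far_hits_second_moment(1)[of "e n" n] L3 by (simp add: Y_def h_def power_divide)
    qed
    \<comment> \<open>The second moment bound divided by \<open>(n\<^sup>2 * b / 4)\<^sup>2\<close>, after \<open>hit_prob \<le> b * q2 p\<close>.\<close>
    let ?u = "\<lambda>n. 128 * cc * cube_mass * (1 / real n) + 96 * cc\<^sup>2 * q2 p * inverse ((real n)\<^sup>2 * b n)"
    show "\<forall>\<^sub>F n in sequentially. expectation (\<lambda>\<omega>. \<bar>Y n \<omega>\<bar>\<^sup>2) \<le> ?u n"
      using ev
    proof eventually_elim
      case (elim n)
      let ?V = "2 * cube_mass * (b n)\<^sup>2 * (4 * cc * real n ^ 3) + (b n * q2 p) * (6 * cc\<^sup>2 * (real n)\<^sup>2)"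
      have bn: "b n > 0" "real n > 0" using elim b by auto
      have "0 \<le> cube_mass" by (simp add: cube_mass_def p_nonneg)
      then have V0: "0 \<le> ?V" using bn q2_nonneg by (simp add: cc_def)
      have "expectation (\<lambda>\<omega>. (hits (?F n) (e n) \<omega> - real (card (?F n)) * h n)\<^sup>2)
          \<le> 2 * cube_mass * (b n)\<^sup>2 * (4 * cc * real n ^ 3) + h n * (6 * cc\<^sup>2 * (real n)\<^sup>2)"
        unfolding b_def h_def cc_def using elim by (intro far_hits_second_moment(2) L3) auto
      also have "\<dots> \<le> ?V"
        unfolding b_def h_def using elim by (intro add_left_mono mult_right_mono hit_prob_le) auto
      finally have "expectation (\<lambda>\<omega>. \<bar>Y n \<omega>\<bar>\<^sup>2) \<le> ?V / (D n)\<^sup>2"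
        by (simp add: Y_def power_divide divide_right_mono)
      also have "\<dots> \<le> ?V / ((real n)\<^sup>2 / 4 * b n)\<^sup>2"
      proof (rule divide_left_mono[OF _ V0])
        have "0 < D n" using D[of n] elim by linarith
        then show "((real n)\<^sup>2 / 4 * b n)\<^sup>2 \<le> (D n)\<^sup>2" "0 < (D n)\<^sup>2 * ((real n)\<^sup>2 / 4 * b n)\<^sup>2"
          using D[of n] elim by (auto simp: power_mono zero_less_mult_iff)
      qed
      also have "\<dots> = ?u n"
        using bn by (simp add: field_simps power2_eq_square power3_eq_cube)
      finally show ?case .
    qed
    have "(\<lambda>n. 1 / real n) \<longlonglongrightarrow> 0" by (rule lim_1_over_n)
    moreover have "(\<lambda>n. inverse ((real n)\<^sup>2 * b n)) \<longlonglongrightarrow> 0"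
      by (rule tendsto_inverse_0_at_top[OF large])
    ultimately have "?u \<longlonglongrightarrow> 128 * cc * cube_mass * 0 + 96 * cc\<^sup>2 * q2 p * 0"
      by (intro tendsto_intros)
    then show "?u \<longlonglongrightarrow> 0" by simp
  qed simp
  moreover have "conv_in_prob M Z 0"
  proof (rule conv_in_prob_of_moment[where k = 1, OF _ meas(2)])
    have hits0: "hits P r \<omega> \<ge> 0" for P r \<omega> unfolding hits_def by (intro sum_nonneg) auto
    have abs: "\<forall>\<^sub>F n in sequentially. \<forall>\<omega>. \<bar>Z n \<omega>\<bar> ^ 1 = hits (?C n) (e n) \<omega> / D n"
      using ev by eventually_elim (use D hits0 in \<open>force simp: Z_def\<close>)
    show "\<forall>\<^sub>F n in sequentially. integrable M (\<lambda>\<omega>. \<bar>Z n \<omega>\<bar> ^ 1)"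
      using abs by eventually_elim (simp add: expectation_near_hits)
    let ?u = "\<lambda>n. 4 * ((\<Sum>k\<in>{1..m}. lag_prob (e n) k) / (real n * b n))"
    show "\<forall>\<^sub>F n in sequentially. expectation (\<lambda>\<omega>. \<bar>Z n \<omega>\<bar> ^ 1) \<le> ?u n"
      using ev abs
    proof eventually_elim
      case (elim n)
      let ?s = "\<Sum>k\<in>{1..m}. lag_prob (e n) k"
      have s0: "0 \<le> ?s" by (intro sum_nonneg) (simp add: lag_prob_def)
      have "expectation (\<lambda>\<omega>. \<bar>Z n \<omega>\<bar> ^ 1) = expectation (hits (?C n) (e n)) / D n"
        using elim(2) by simp
      also have "\<dots> \<le> (real n * ?s) / D n"
        using D[of n] elim by (intro divide_right_mono expectation_near_hits) auto
      also have "\<dots> \<le> (real n * ?s) / ((real n)\<^sup>2 / 4 * b n)"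
        using D[of n] elim s0 by (intro divide_left_mono) auto
      also have "\<dots> = ?u n" using elim by (simp add: power2_eq_square)
      finally show ?case .
    qed
    show "?u \<longlonglongrightarrow> 0" using tendsto_mult_left[OF lags, of 4] by simp
  qed simp
  moreover have "c \<longlonglongrightarrow> q2 p"
  proof -
    have "(\<lambda>n. real (card (?F n)) / real (n choose 2)) \<longlonglongrightarrow> 1"
    proof (rule tendsto_sandwich)
      show "(\<lambda>n. 1 - 4 * real m * (1 / real n)) \<longlonglongrightarrow> 1"
        using tendsto_diff[OF tendsto_const tendsto_mult_right_zero[OF lim_1_over_n]] by simp
      show "\<forall>\<^sub>F n in sequentially. 1 - 4 * real m * (1 / real n) \<le> real (card (?F n)) / real (n choose 2)"
        using ev
      proof eventually_elim
        case (elim n)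
        have p: "real (n choose 2) > 0" using choose[of n] elim by (auto intro: less_le_trans[rotated])
        have "real (card (?F n)) = real (n choose 2) - real (card (?C n))"
          using card_pairs[of n] by linarith
        then have "real (card (?F n)) / real (n choose 2) = 1 - real (card (?C n)) / real (n choose 2)"
          using p by (simp add: diff_divide_distrib)
        moreover have "real (card (?C n)) / real (n choose 2) \<le> (real n * real m) / ((real n)\<^sup>2 / 4)"
          using choose[of n] elim p card_near_pairs_le[of n]
          by (intro frac_le) (auto simp: of_nat_mult[symmetric] simp del: of_nat_mult)
        moreover have "(real n * real m) / ((real n)\<^sup>2 / 4) = 4 * real m * (1 / real n)"
          using elim by (simp add: power2_eq_square)
        ultimately show ?case by linarith
      qed
      show "\<forall>\<^sub>F n in sequentially. real (card (?F n)) / real (n choose 2) \<le> 1"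
      proof (intro always_eventually allI)
        fix n
        have "card (?F n) \<le> n choose 2" using card_pairs[of n] by simp
        then show "real (card (?F n)) / real (n choose 2) \<le> 1" by (cases "n < 2") (auto simp: divide_le_eq_1)
      qed
    qed simp
    then have "(\<lambda>n. real (card (?F n)) / real (n choose 2) * (h n / b n)) \<longlonglongrightarrow> 1 * q2 p"
      unfolding h_def b_def by (intro tendsto_mult hit_prob_asymp e)
    then show ?thesis by (simp add: c_def D_def)
  qed
  ultimately show ?thesis
  proof (rule conv_in_prob_perturb[OF _ _ _ meas])
    fix n \<omega> assume "\<omega> \<in> space M"
    then show "pair_count (e n) n \<omega> / real (n choose 2) / b n = Y n \<omega> + Z n \<omega> + c n"
      by (simp add: pair_count_split Y_def Z_def c_def D_def diff_divide_distrib add_divide_distrib)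
  qed
qed

end

section \<open>Close pairs at short lags\<close>

lemma nn_integral_lborel_iterated:
  fixes f :: "'a::euclidean_space \<times> 'b::euclidean_space \<Rightarrow> ennreal"
  assumes "f \<in> borel_measurable borel"
  shows "(\<integral>\<^sup>+ z. f z \<partial>lborel) = (\<integral>\<^sup>+ x. \<integral>\<^sup>+ y. f (x, y) \<partial>lborel \<partial>lborel)"
proof -
  have "f \<in> borel_measurable (lborel \<Otimes>\<^sub>M lborel)"
    using assms by (simp only: lborel_prod measurable_lborel2)
  then have "(\<integral>\<^sup>+ x. \<integral>\<^sup>+ y. f (x, y) \<partial>lborel \<partial>lborel) = (\<integral>\<^sup>+ z. f z \<partial>(lborel \<Otimes>\<^sub>M lborel))"
    by (rule lborel.nn_integral_fst)
  then show ?thesis by (simp only: lborel_prod)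
qed

text \<open>
  The Cauchy-Schwarz inequality in the last two variables: the indicator of a product of two balls
  of volume \<open>b\<close> each has \<open>L\<^sub>2\<close> norm \<open>b\<close>.
\<close>

lemma nn_integral_ball_pair_le_partial_L2_norm:
  fixes f :: "'v::euclidean_space \<times> 'v \<times> 'v \<times> 'v \<Rightarrow> real"
  assumes f0: "\<And>z. 0 \<le> f z" and f: "(\<lambda>z. ennreal (f z)) \<in> borel_measurable borel" and e: "e > 0"
  shows "(\<integral>\<^sup>+ w. ennreal (f (x1, x2, w)) * (near e x1 (fst w) * near e x2 (snd w)) \<partial>lborel)
    \<le> partial_L2_norm f (x1, x2) * ennreal (ball_vol DIM('v) e)"
proof -
  let ?b = "ball_vol DIM('v) e"
  let ?g = "\<lambda>w. near e x1 (fst w) * near e x2 (snd w)"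
  let ?I = "\<integral>\<^sup>+ w. ennreal (f (x1, x2, w)) * ?g w \<partial>lborel"
  let ?S = "\<integral>\<^sup>+ w. ennreal ((f (x1, x2, w))\<^sup>2) \<partial>lborel"
  have b: "?b > 0" using e by (intro ball_vol_pos) auto
  have g_meas: "?g \<in> borel_measurable borel"
    by (intro borel_measurable_times_ennreal near_measurable borel_measurable_const)
       (intro borel_measurable_continuous_onI continuous_intros)+
  have f_meas: "(\<lambda>w. ennreal (f (x1, x2, w))) \<in> borel_measurable borel"
  proof -
    have "(\<lambda>w. (x1, x2, w)) \<in> borel \<rightarrow>\<^sub>M (borel :: ('v \<times> 'v \<times> 'v \<times> 'v) measure)"
      by (intro borel_measurable_continuous_onI continuous_intros)
    from measurable_compose[OF this f] show ?thesis .
  qed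
  have "(\<integral>\<^sup>+ w. (?g w)\<^sup>2 \<partial>lborel) = (\<integral>\<^sup>+ w. ?g w \<partial>lborel)"
    by (intro nn_integral_cong) (auto simp: near_def)
  also have "\<dots> = (\<integral>\<^sup>+ y. \<integral>\<^sup>+ z. near e x1 y * near e x2 z \<partial>lborel \<partial>lborel)"
    by (subst nn_integral_lborel_iterated[OF g_meas]) simp
  also have "\<dots> = ennreal ?b * ennreal ?b"
    using e by (simp add: nn_integral_cmult nn_integral_multc nn_integral_near)
  finally have g: "(\<integral>\<^sup>+ w. (?g w)\<^sup>2 \<partial>lborel) = ennreal (?b\<^sup>2)"
    using b by (simp add: power2_eq_square ennreal_mult)
  have "?I\<^sup>2 \<le> (\<integral>\<^sup>+ w. (ennreal (f (x1, x2, w)))\<^sup>2 \<partial>lborel) * (\<integral>\<^sup>+ w. (?g w)\<^sup>2 \<partial>lborel)"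
    by (rule Cauchy_Schwarz_nn_integral) (simp_all only: measurable_lborel1 measurable_lborel2 f_meas g_meas)
  then have CS: "?I\<^sup>2 \<le> ?S * ennreal (?b\<^sup>2)"
    by (simp add: g f0 ennreal_power)
  have norm: "partial_L2_norm f (x1, x2) = ennreal_sqrt ?S"
    by (simp add: partial_L2_norm_def case_prod_unfold)
  show ?thesis
  proof (cases "?S = \<top>")
    case True
    then show ?thesis using b by (simp add: norm ennreal_sqrt_def ennreal_top_mult)
  next
    case False
    then obtain s where s: "?S = ennreal s" "s \<ge> 0" by (cases ?S) auto
    then have "?S * ennreal (?b\<^sup>2) < \<top>" by (simp add: ennreal_mult_less_top)
    with CS have "?I\<^sup>2 < \<top>" by (rule le_less_trans)
    then have "?I \<noteq> \<top>" by auto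
    then obtain i where i: "?I = ennreal i" "i \<ge> 0" by (cases ?I) auto
    have "i\<^sup>2 \<le> s * ?b\<^sup>2"
      using CS s i b by (simp add: ennreal_power ennreal_mult[symmetric])
    then have "i \<le> sqrt (s * ?b\<^sup>2)" by (rule real_le_rsqrt)
    also have "\<dots> = sqrt s * ?b" using b by (simp add: real_sqrt_mult)
    finally have "ennreal i \<le> ennreal (sqrt s * ?b)" by (rule ennreal_leI)
    then show ?thesis using s i b by (simp add: norm ennreal_sqrt_def ennreal_mult)
  qed
qed

context m_dependent_sample
begin

text \<open>
  The second pair is the first one shifted by \<open>k + m + 1\<close>, the smallest shift for which the gap
  between the blocks exceeds \<open>m\<close>.
\<close>

lemma lag_prob_square:
  "(lag_prob e k)\<^sup>2 = prob (close_event e 1 (1 + k) \<inter> close_event e (k + m + 2) (k + m + 2 + k))"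
proof -
  let ?b = "k + m + 2"
  let ?A = "{1 + k - k..1 + k}" and ?B = "{?b..?b + k}"
  let ?EA = "{z \<in> space (PiM ?A (\<lambda>_. borel :: 'v measure)). norm (z 1 - z (1 + k)) \<le> e}"
  let ?EB = "{z \<in> space (PiM ?B (\<lambda>_. borel :: 'v measure)). norm (z ?b - z (?b + k)) \<le> e}"
  let ?XA = "\<lambda>\<omega>. \<lambda>i\<in>?A. X i \<omega>" and ?XB = "\<lambda>\<omega>. \<lambda>i\<in>?B. X i \<omega>"
  have "indep_var (PiM ?A (\<lambda>_. borel)) ?XA (PiM ?B (\<lambda>_. borel)) ?XB"
    by (rule m_dep[unfolded m_dependent_def, THEN spec[of _ "1 + k"], THEN spec[of _ ?b],
          THEN spec[of _ k], THEN spec[of _ k], THEN mp]) auto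
  then have "prob ((\<lambda>x. (?XA x, ?XB x)) -` (?EA \<times> ?EB) \<inter> space M) = prob (?XA -` ?EA \<inter> space M) * prob (?XB -` ?EB \<inter> space M)"
    by (rule indep_varD) measurable
  also have "?XA -` ?EA \<inter> space M = close_event e 1 (1 + k)"
    by (auto simp: close_event_def space_PiM PiE_iff)
  also have "?XB -` ?EB \<inter> space M = close_event e ?b (?b + k)"
    by (auto simp: close_event_def space_PiM PiE_iff)
  also have "(\<lambda>x. (?XA x, ?XB x)) -` (?EA \<times> ?EB) \<inter> space M = close_event e 1 (1 + k) \<inter> close_event e ?b (?b + k)"
    by (auto simp: close_event_def space_PiM PiE_iff)
  also have "prob (close_event e ?b (?b + k)) = lag_prob e k" by (rule prob_close_event_lag) simp
  also have "prob (close_event e 1 (1 + k)) = lag_prob e k" by (simp add: lag_prob_def)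
  finally show ?thesis by (simp add: power2_eq_square)
qed

text \<open>
  The order of the four indices given to Assumption A matters. The first pair occupies positions 1
  and 3 and the shifted pair positions 2 and 4, so that, with the first two points fixed, closeness
  confines the last two to balls, and integrability of the partial norm finishes the estimate.
\<close>

lemma lag_prob_square_le:
  assumes A: "assumption_A M X p" and k: "k \<ge> 1"
  shows "\<exists>C\<ge>0. \<forall>e>0. (lag_prob e k)\<^sup>2 \<le> C * ball_vol DIM('v) e"
proof -
  let ?t = "k + m + 2"
  have "distinct [1, ?t, 1 + k, ?t + k] \<and> set [1, ?t, 1 + k, ?t + k] \<subseteq> {1..}" using k by auto
  then obtain f where f: "\<And>z. 0 \<le> f z"
      "distributed M lborel (\<lambda>\<omega>. (X 1 \<omega>, X ?t \<omega>, X (1 + k) \<omega>, X (?t + k) \<omega>)) (\<lambda>z. ennreal (f z))"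
      "partial_L2_norm f \<in> borel_measurable lborel"
      "(\<integral>\<^sup>+ z. partial_L2_norm f z \<partial>lborel) < \<infinity>"
    using A unfolding assumption_A_def by meson
  have f_meas: "(\<lambda>z. ennreal (f z)) \<in> borel_measurable borel"
    using f(2) by (auto dest: distributed_borel_measurable)
  define C where "C = enn2real (\<integral>\<^sup>+ z. partial_L2_norm f z \<partial>lborel)"
  have C: "ennreal C = (\<integral>\<^sup>+ z. partial_L2_norm f z \<partial>lborel)" "C \<ge> 0"
    using f(4) by (auto simp: C_def)
  have "(lag_prob e k)\<^sup>2 \<le> C * ball_vol DIM('v) e" if e: "e > 0" for e
  proof -
    have b: "ball_vol DIM('v) e > 0" using e by (intro ball_vol_pos) auto
    let ?g = "\<lambda>z :: 'v \<times> 'v \<times> 'v \<times> 'v. near e (fst z) (fst (snd (snd z))) * near e (fst (snd z)) (snd (snd (snd z)))"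
    have proj: "(\<lambda>z :: 'v \<times> 'v \<times> 'v \<times> 'v. fst z) \<in> borel_measurable borel"
        "(\<lambda>z :: 'v \<times> 'v \<times> 'v \<times> 'v. fst (snd z)) \<in> borel_measurable borel"
        "(\<lambda>z :: 'v \<times> 'v \<times> 'v \<times> 'v. fst (snd (snd z))) \<in> borel_measurable borel"
        "(\<lambda>z :: 'v \<times> 'v \<times> 'v \<times> 'v. snd (snd (snd z))) \<in> borel_measurable borel"
      by (intro borel_measurable_continuous_onI continuous_intros)+
    have g [measurable]: "?g \<in> borel_measurable borel"
      by (intro borel_measurable_times_ennreal near_measurable proj)
    let ?h = "\<lambda>z. ennreal (f z) * ?g z"
    have h: "?h \<in> borel_measurable borel" using f_meas g by (rule borel_measurable_times_ennreal)
    have h1: "(\<lambda>z. ?h (x, z)) \<in> borel_measurable borel" for x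
      by (rule measurable_compose[OF _ h]) (intro borel_measurable_continuous_onI continuous_intros)
    have "ennreal ((lag_prob e k)\<^sup>2) = (\<integral>\<^sup>+ \<omega>. near e (X 1 \<omega>) (X (1 + k) \<omega>) * near e (X ?t \<omega>) (X (?t + k) \<omega>) \<partial>M)"
      unfolding lag_prob_square emeasure_eq_measure[symmetric]
      by (rule emeasure_close_event_Int) auto
    also have "\<dots> = (\<integral>\<^sup>+ z. ?h z \<partial>lborel)"
      using distributed_nn_integral[OF f(2), of ?g] by simp
    also have "\<dots> = (\<integral>\<^sup>+ x1. \<integral>\<^sup>+ z. ?h (x1, z) \<partial>lborel \<partial>lborel)"
      by (rule nn_integral_lborel_iterated[OF h])
    also have "\<dots> = (\<integral>\<^sup>+ x1. \<integral>\<^sup>+ x2. \<integral>\<^sup>+ w. ?h (x1, x2, w) \<partial>lborel \<partial>lborel \<partial>lborel)"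
      by (intro nn_integral_cong nn_integral_lborel_iterated[OF h1])
    also have "\<dots> \<le> (\<integral>\<^sup>+ x1. \<integral>\<^sup>+ x2. partial_L2_norm f (x1, x2) * ennreal (ball_vol DIM('v) e) \<partial>lborel \<partial>lborel)"
      using nn_integral_ball_pair_le_partial_L2_norm[OF f(1) f_meas e]
      by (intro nn_integral_mono) simp
    also have "\<dots> = (\<integral>\<^sup>+ z. partial_L2_norm f z * ennreal (ball_vol DIM('v) e) \<partial>lborel)"
      using f(3) by (intro nn_integral_lborel_iterated[symmetric] borel_measurable_times_ennreal) simp_all
    also have "\<dots> = ennreal (C * ball_vol DIM('v) e)"
      using f(3) C b by (simp add: nn_integral_multc ennreal_mult)
    finally show ?thesis using C b by (simp add: ennreal_le_iff)
  qed
  then show ?thesis using C(2) by blast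
qed

lemma lag_prob_nonneg: "0 \<le> lag_prob e k"
  by (simp add: lag_prob_def)

text \<open>
  Almost surely the distance of the two vectors is positive, hence eventually larger than the radius.
\<close>

lemma lag_prob_tendsto_0:
  assumes ne: "prob {\<omega> \<in> space M. X 1 \<omega> \<noteq> X (1 + k) \<omega>} = 1" and e: "e \<longlonglongrightarrow> 0"
  shows "(\<lambda>n. lag_prob (e n) k) \<longlonglongrightarrow> 0"
proof -
  have [measurable]: "X 1 \<in> borel_measurable M" "X (1 + k) \<in> borel_measurable M"
    by (auto intro: X_measurable)
  have "AE \<omega> in M. X 1 \<omega> \<noteq> X (1 + k) \<omega>"
  proof -
    have "{\<omega> \<in> space M. X 1 \<omega> \<noteq> X (1 + k) \<omega>} \<in> events" by measurable
    from prob_Collect_eq_1[OF this] ne show ?thesis by simp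
  qed
  then have "AE \<omega> in M. (\<lambda>n. indicat_real (close_event (e n) 1 (1 + k)) \<omega>) \<longlonglongrightarrow> 0"
  proof eventually_elim
    case (elim \<omega>)
    then have "0 < norm (X 1 \<omega> - X (1 + k) \<omega>)" by simp
    with e have "\<forall>\<^sub>F n in sequentially. e n < norm (X 1 \<omega> - X (1 + k) \<omega>)" by (rule order_tendstoD)
    then have "\<forall>\<^sub>F n in sequentially. indicat_real (close_event (e n) 1 (1 + k)) \<omega> = 0"
      by eventually_elim (auto simp: close_event_def)
    then show ?case by (rule tendsto_eventually)
  qed
  then have "(\<lambda>n. \<integral>\<omega>. indicat_real (close_event (e n) 1 (1 + k)) \<omega> \<partial>M) \<longlonglongrightarrow> (\<integral>\<omega>. 0 \<partial>M)"
    by (intro integral_dominated_convergence[where w = "\<lambda>_. 1"])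
       (auto intro!: borel_measurable_indicator close_event_measurable)
  then show ?thesis
    by (simp add: lag_prob_def close_event_measurable)
qed

text \<open>
  Each lag probability is \<open>O(sqrt b)\<close>, and \<open>sqrt b / (n * b) = 1 / sqrt (n\<^sup>2 * b)\<close>.
\<close>

lemma lag_sum_negligible_assumption_A:
  fixes e :: "nat \<Rightarrow> real"
  defines "b \<equiv> (\<lambda>n. ball_vol DIM('v) (e n))"
  assumes A: "assumption_A M X p" and e: "\<forall>\<^sub>F n in sequentially. e n > 0"
    and large: "filterlim (\<lambda>n. (real n)\<^sup>2 * b n) at_top sequentially"
  shows "(\<lambda>n. (\<Sum>k\<in>{1..m}. lag_prob (e n) k) / (real n * b n)) \<longlonglongrightarrow> 0"
proof -
  obtain C where C: "\<And>k. k \<ge> 1 \<Longrightarrow> C k \<ge> 0 \<and> (\<forall>e>0. (lag_prob e k)\<^sup>2 \<le> C k * ball_vol DIM('v) e)"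
    using lag_prob_square_le[OF A] by metis
  define K where "K = (\<Sum>k\<in>{1..m}. sqrt (C k))"
  show ?thesis
  proof (rule tendsto_sandwich[where f = "\<lambda>_. 0"])
    show "\<forall>\<^sub>F n in sequentially. 0 \<le> (\<Sum>k\<in>{1..m}. lag_prob (e n) k) / (real n * b n)"
      using e
    proof eventually_elim
      case (elim n)
      have "b n > 0" unfolding b_def using elim by (intro ball_vol_pos) auto
      then show ?case by (intro divide_nonneg_nonneg sum_nonneg lag_prob_nonneg) auto
    qed
    show "\<forall>\<^sub>F n in sequentially. (\<Sum>k\<in>{1..m}. lag_prob (e n) k) / (real n * b n) \<le> K * inverse (sqrt ((real n)\<^sup>2 * b n))"
      using e eventually_gt_at_top[of 0]
    proof eventually_elim
      case (elim n)
      have b: "b n > 0" unfolding b_def using elim by (intro ball_vol_pos) auto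
      have "(\<Sum>k\<in>{1..m}. lag_prob (e n) k) \<le> (\<Sum>k\<in>{1..m}. sqrt (C k) * sqrt (b n))"
      proof (rule sum_mono)
        fix k assume "k \<in> {1..m}"
        then have "(lag_prob (e n) k)\<^sup>2 \<le> C k * b n" using C[of k] elim by (auto simp: b_def)
        then show "lag_prob (e n) k \<le> sqrt (C k) * sqrt (b n)"
          unfolding real_sqrt_mult[symmetric] by (rule real_le_rsqrt)
      qed
      then have "(\<Sum>k\<in>{1..m}. lag_prob (e n) k) / (real n * b n) \<le> K * sqrt (b n) / (real n * b n)"
        using b by (intro divide_right_mono) (auto simp: K_def sum_distrib_right)
      also have "\<dots> = K * inverse (sqrt ((real n)\<^sup>2 * b n))"
      proof -
        define r where "r = sqrt (b n)"
        have r: "b n = r * r" "r > 0" using b by (auto simp: r_def)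
        then have "sqrt (b n) = r" "sqrt ((real n)\<^sup>2 * b n) = real n * r"
          by (simp_all add: real_sqrt_mult)
        then show ?thesis using r elim by (simp add: field_simps)
      qed
      finally show ?case .
    qed
    have "(\<lambda>n. inverse (sqrt ((real n)\<^sup>2 * b n))) \<longlonglongrightarrow> 0"
      by (intro tendsto_inverse_0_at_top filterlim_compose[OF sqrt_at_top large])
    then show "(\<lambda>n. K * inverse (sqrt ((real n)\<^sup>2 * b n))) \<longlonglongrightarrow> 0"
      by (rule tendsto_mult_right_zero)
  qed simp
qed

lemma lag_sum_negligible_no_ties:
  fixes e :: "nat \<Rightarrow> real"
  defines "b \<equiv> (\<lambda>n. ball_vol DIM('v) (e n))"
  assumes ne: "\<And>k. k \<ge> 1 \<Longrightarrow> prob {\<omega> \<in> space M. X 1 \<omega> \<noteq> X (1 + k) \<omega>} = 1" and e: "e \<longlonglongrightarrow> 0"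
    and c: "c > 0" "\<forall>\<^sub>F n in sequentially. c \<le> real n * b n"
  shows "(\<lambda>n. (\<Sum>k\<in>{1..m}. lag_prob (e n) k) / (real n * b n)) \<longlonglongrightarrow> 0"
proof (rule tendsto_sandwich[where f = "\<lambda>_. 0"])
  have s0: "0 \<le> (\<Sum>k\<in>{1..m}. lag_prob r k)" for r by (intro sum_nonneg lag_prob_nonneg)
  show "\<forall>\<^sub>F n in sequentially. 0 \<le> (\<Sum>k\<in>{1..m}. lag_prob (e n) k) / (real n * b n)"
    using c(2) by eventually_elim (use c(1) s0 in \<open>auto intro!: divide_nonneg_nonneg\<close>)
  show "\<forall>\<^sub>F n in sequentially. (\<Sum>k\<in>{1..m}. lag_prob (e n) k) / (real n * b n) \<le> (\<Sum>k\<in>{1..m}. lag_prob (e n) k) / c"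
    using c(2)
  proof eventually_elim
    case (elim n)
    then have "0 < real n * b n" using c(1) by linarith
    then show ?case by (intro divide_left_mono elim s0 mult_pos_pos[OF _ c(1)])
  qed
  have "(\<lambda>n. \<Sum>k\<in>{1..m}. lag_prob (e n) k) \<longlonglongrightarrow> (\<Sum>k\<in>{1..m}. 0)"
    using ne e by (intro tendsto_sum lag_prob_tendsto_0) auto
  then show "(\<lambda>n. (\<Sum>k\<in>{1..m}. lag_prob (e n) k) / c) \<longlonglongrightarrow> 0"
    using c(1) by (simp add: tendsto_divide_zero)
qed simp

end

theorem theorem2:
  fixes M :: "'a measure"
    and X :: "nat \<Rightarrow> 'a \<Rightarrow> real^'d"
    and p :: "real^'d \<Rightarrow> real"
    and \<epsilon> :: "nat \<Rightarrow> real"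
    and m :: nat
  assumes "prob_space M"
    and "strictly_stationary M X"
    and "m_dependent M m X"
    and "\<And>x. 0 \<le> p x"
    and "\<And>i. i \<ge> 1 \<Longrightarrow> distributed M lborel (X i) (\<lambda>x. ennreal (p x))"
    and "in_L 2 p"
    and "\<And>n. n \<ge> 1 \<Longrightarrow> \<epsilon> n > 0"
    and "\<epsilon> \<longlonglongrightarrow> 0"
  shows
    "(assumption_A M X p \<and>
      filterlim (\<lambda>n. (real n)\<^sup>2 * \<epsilon> n ^ CARD('d)) at_top sequentially
      \<longrightarrow> conv_in_prob M (Q_est X \<epsilon>) (q2 p) \<and> conv_in_prob M (H_est X \<epsilon>) (h2 p))
     \<and>
     (\<forall>a::ereal.
        in_L 3 p \<and>
        (\<forall>i\<ge>1. \<forall>j\<ge>1. i \<noteq> j \<longrightarrow> measure M {\<omega> \<in> space M. X i \<omega> \<noteq> X j \<omega>} = 1) \<and>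
        (\<lambda>n. ereal (real n * \<epsilon> n ^ CARD('d))) \<longlonglongrightarrow> a \<and> 0 < a \<and> a \<le> \<infinity>
      \<longrightarrow> conv_in_prob M (Q_est X \<epsilon>) (q2 p) \<and> conv_in_prob M (H_est X \<epsilon>) (h2 p))"
proof -
  interpret m_dependent_sample M X p m
    using assms by (intro m_dependent_sample.intro m_dependent_sample_axioms.intro) auto
  define u where "u = unit_ball_vol (real CARD('d))"
  have u: "u > 0" by (simp add: u_def)
  define b where "b = (\<lambda>n. ball_vol DIM(real^'d) (\<epsilon> n))"
  have b_eq: "b n = u * \<epsilon> n ^ CARD('d)" for n
    by (simp add: b_def u_def ball_vol_eq_unit_ball_vol)
  have pos: "\<forall>\<^sub>F n in sequentially. \<epsilon> n > 0"
    using eventually_ge_at_top[of 1] by eventually_elim (rule assms(7))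
  have Q: "Q_est X \<epsilon> = (\<lambda>n \<omega>. pair_count (\<epsilon> n) n \<omega> / real (n choose 2) / b n)"
    by (simp add: Q_est_def N_est_def pair_count_def b_def fun_eq_iff)
  have pair_count_meas: "pair_count r n \<in> borel_measurable M" for r n
  proof -
    have "hits (far_pairs n) r \<in> borel_measurable M" "hits (near_pairs n) r \<in> borel_measurable M"
      by (intro hits_measurable; auto simp: far_pairs_def near_pairs_def)+
    then have "(\<lambda>\<omega>. hits (far_pairs n) r \<omega> + hits (near_pairs n) r \<omega>) \<in> borel_measurable M"
      by (rule borel_measurable_add)
    then show ?thesis by (simp add: pair_count_split cong: measurable_cong)
  qed
  have Q_meas: "Q_est X \<epsilon> n \<in> borel_measurable M" for n
    unfolding Q using pair_count_meas by (intro borel_measurable_divide) auto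
  have conclusion: "conv_in_prob M (Q_est X \<epsilon>) (q2 p) \<and> conv_in_prob M (H_est X \<epsilon>) (h2 p)"
    if "in_L 3 p" "filterlim (\<lambda>n. (real n)\<^sup>2 * b n) at_top sequentially"
      "(\<lambda>n. (\<Sum>k\<in>{1..m}. lag_prob (\<epsilon> n) k) / (real n * b n)) \<longlonglongrightarrow> 0"
  proof
    show *: "conv_in_prob M (Q_est X \<epsilon>) (q2 p)"
      unfolding Q b_def using that by (intro pair_count_consistent pos assms(8)) (auto simp: b_def)
    show "conv_in_prob M (H_est X \<epsilon>) (h2 p)"
      using conv_in_prob_neg_ln[OF * q2_pos Q_meas] by (simp add: H_est_def[abs_def] h2_def)
  qed
  have large: "filterlim (\<lambda>n. (real n)\<^sup>2 * b n) at_top sequentially"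
    if "filterlim (\<lambda>n. (real n)\<^sup>2 * \<epsilon> n ^ CARD('d)) at_top sequentially"
    using filterlim_tendsto_pos_mult_at_top[OF tendsto_const u that] by (simp add: b_eq mult.left_commute)
  show ?thesis
  proof (intro conjI allI impI; (elim conjE)?)
    assume A: "assumption_A M X p" and n2: "filterlim (\<lambda>n. (real n)\<^sup>2 * \<epsilon> n ^ CARD('d)) at_top sequentially"
    have "in_L 3 p" using A by (simp add: assumption_A_def)
    with conclusion[OF this large[OF n2]] lag_sum_negligible_assumption_A[OF A pos] large[OF n2]
    show "conv_in_prob M (Q_est X \<epsilon>) (q2 p)" "conv_in_prob M (H_est X \<epsilon>) (h2 p)"
      by (auto simp: b_def)
  next
    fix a :: ereal
    assume L3: "in_L 3 p"
      and ne: "\<forall>i\<ge>1. \<forall>j\<ge>1. i \<noteq> j \<longrightarrow> prob {\<omega> \<in> space M. X i \<omega> \<noteq> X j \<omega>} = 1"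
      and lim: "(\<lambda>n. ereal (real n * \<epsilon> n ^ CARD('d))) \<longlonglongrightarrow> a" and a: "0 < a"
    \<comment> \<open>A real lower bound covers finite and infinite \<open>a\<close> alike.\<close>
    obtain c where c: "0 < ereal c" "ereal c < a" using ereal_dense2[OF a] by auto
    have ev: "\<forall>\<^sub>F n in sequentially. c < real n * \<epsilon> n ^ CARD('d)"
      using order_tendstoD(1)[OF lim c(2)] by simp
    have "filterlim (\<lambda>n. c * real n) at_top sequentially"
      using c(1) by (intro filterlim_tendsto_pos_mult_at_top[OF tendsto_const] filterlim_real_sequentially) simp
    then have n2: "filterlim (\<lambda>n. (real n)\<^sup>2 * \<epsilon> n ^ CARD('d)) at_top sequentially"
    proof (rule filterlim_at_top_mono)
      show "\<forall>\<^sub>F n in sequentially. c * real n \<le> (real n)\<^sup>2 * \<epsilon> n ^ CARD('d)"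
        using ev
      proof eventually_elim
        case (elim n)
        then have "c * real n \<le> (real n * \<epsilon> n ^ CARD('d)) * real n" by (intro mult_right_mono) auto
        then show ?case by (simp add: power2_eq_square mult_ac)
      qed
    qed
    have "\<forall>\<^sub>F n in sequentially. u * c \<le> real n * b n"
      using ev
    proof eventually_elim
      case (elim n)
      then have "u * c \<le> u * (real n * \<epsilon> n ^ CARD('d))" using u by (intro mult_left_mono) auto
      then show ?case by (simp add: b_eq mult.left_commute)
    qed
    moreover have "u * c > 0" using u c by simp
    ultimately have "(\<lambda>n. (\<Sum>k\<in>{1..m}. lag_prob (\<epsilon> n) k) / (real n * b n)) \<longlonglongrightarrow> 0"
      unfolding b_def using ne assms(8) by (intro lag_sum_negligible_no_ties) auto
    with conclusion[OF L3 large[OF n2]]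
    show "conv_in_prob M (Q_est X \<epsilon>) (q2 p)" "conv_in_prob M (H_est X \<epsilon>) (h2 p)" by auto
  qed
qed

end
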